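(* Let $\mathcal S:=\{p,{\sim}p\}$ and $\mathcal S^{\circ}:=\mathcal S\cup\{{\sim}p,\circ p,{\sim}\circ p\}$. The symmetrical Hilbert-style calculus $\mathsf R_{\mathcal B}\cup\mathsf R_{\circ}$ is an $\mathcal S^{\circ}$-analytic axiomatization of the order-preserving logic $\mathcal{PP}_{\leq}^{\rhd}$ of perfect paradefinite algebras; that is, $\rhd_{\mathsf R_{\mathcal B}\cup\mathsf R_\circ}=\mathcal{PP}_\leq^{\rhd}$ and $\mathsf R_{\mathcal B}\cup\mathsf R_\circ$ is $\mathcal S^{\circ}$-analytic.
   Context: Formulas are over $\{\land,\lor,\sim,\circ,\top,\bot\}$ and a denumerable set $P$ of variables. Logic. A De Morgan algebra is a bounded distributive lattice with unary $\sim$ satisfying ${\sim}{\sim}x\approx x$, ${\sim}(x\land y)\approx{\sim}x\lor{\sim}y$. A perfect paradefinite algebra (PP-algebra) is a De Morgan algebra with unary $\circ$ satisfying $\circ\circ x\approx\top$; $\circ x\approx\circ{\sim}x$; $\circ\top\approx\top$; $x\land{\sim}x\land\circ x\approx\bot$; $\circ(x\land y)\approx(\circ x\lor\circ y)\land(\circ x\lor{\sim}y)\land(\circ y\lor{\sim}x)$. In $\mathcal{PP}_\leq^{\rhd}$, $\Psi$ follows from $\Phi$ iff there are finite $\Phi'\subseteq\Phi$, $\Psi'\subseteq\Psi$ such that $\bigwedge\Phi'\approx\bigwedge\Phi'\land\bigvee\Psi'$ is valid in all PP-algebras ($\bigwedge\varnothing=\top$, $\bigvee\varnothing=\bot$).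 Symmetrical calculi. A symmetrical (Set-Set) calculus $\mathsf R$ is a set of rules $\frac{\Pi}{\Theta}$ with $\Pi,\Theta$ sets of formulas. An $\mathsf R$-derivation is a rooted tree in which the ancestors of each node are well-ordered and every branch ends in a leaf, with nodes labelled by sets of formulas or by the symbol $*$, such that for each non-leaf node $n$ with label $\ell(n)$ there are a rule $\frac{\Pi}{\Theta}\in\mathsf R$ and a substitution $\sigma$ with $\sigma(\Pi)\subseteq\ell(n)$ and: if $\Theta\neq\varnothing$, the children of $n$ are nodes $n^{\varphi}$ for $\varphi\in\sigma(\Theta)$, labelled $\ell(n)\cup\{\varphi\}$; if $\Theta=\varnothing$, $n$ has a single child, labelled $*$. $\Phi\rhd_{\mathsf R}\Psi$ iff there is an $\mathsf R$-derivation whose root label is contained in $\Phi$ and each of whose leaves is labelled $*$ or by a set intersecting $\Psi$. $\Phi\rhd_{\mathsf R}^{\Lambda}\Psi$ means that there is such a derivation using only formulas in $\Lambda$. For a set $\Xi$ of formulas, $\mathsf R$ is $\Xi$-analytic if, whenever $\Phi\rhd_{\mathsf R}\Psi$, also $\Phi\rhd_{\mathsf R}^{\Upsilon}\Psi$ with $\Upsilon=\mathsf{sub}(\Phi\cup\Psi)\cup\{\sigma(\varphi):\varphi\in\Xi,\ \sigma:P\to\mathsf{sub}(\Phi\cup\Psi)\}$, where $\mathsf{sub}$ denotes the set of subformulas. Rules, written $\Pi\,/\,\Theta$ (an empty side means $\varnothing$). $\mathsf R_{\mathcal B}$ consists of: $\ /\ \top$; ${\sim}\top\ /\ $; $\ /\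 {\sim}\bot$; $\bot\ /\ $; $p\ /\ {\sim}{\sim}p$; ${\sim}{\sim}p\ /\ p$; $p\land q\ /\ p$; $p\land q\ /\ q$; $p,q\ /\ p\land q$; ${\sim}p\ /\ {\sim}(p\land q)$; ${\sim}q\ /\ {\sim}(p\land q)$; ${\sim}(p\land q)\ /\ {\sim}p,{\sim}q$; $p\ /\ p\lor q$; $q\ /\ p\lor q$; $p\lor q\ /\ p,q$; ${\sim}p,{\sim}q\ /\ {\sim}(p\lor q)$; ${\sim}(p\lor q)\ /\ {\sim}p$; ${\sim}(p\lor q)\ /\ {\sim}q$. $\mathsf R_{\circ}$ consists of: $\ /\ \circ\bot$; $\ /\ \circ\top$; $\ /\ \circ\circ p$; $\circ p\ /\ \circ{\sim}p$; $\circ{\sim}p\ /\ \circ p$; $\circ p\ /\ p,{\sim}p$; $\circ p,p,{\sim}p\ /\ $; $\circ p\ /\ \circ(p\land q),p$; $\circ q\ /\ \circ(p\land q),q$; $\circ(p\land q),q\ /\ \circ p$; $\circ(p\land q),p\ /\ \circ q$; $\circ p,\circ q\ /\ \circ(p\land q)$; $\circ(p\land q)\ /\ \circ p,\circ q$; $\circ p,\circ q\ /\ \circ(p\lor q)$; $\circ(p\lor q)\ /\ \circ p,\circ q$; $\circ p,p\ /\ \circ(p\lor q)$; $\circ q,q\ /\ \circ(p\lor q)$; $\circ(p\lor q)\ /\ \circ p,q$; $\circ(p\lor q)\ /\ \circ q,p$.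
   Formalization: Derivations must also label each limit node (neither the root nor a child of any node) with the union of its ancestors' labels; without this, an ω-chain of uses of the rule "/ ⊤" topped by a leaf labelled * would derive every sequent. *)

theory Defs
  imports Main
begin

section \<open>Formulas\<close>

text \<open>The denumerable set of propositional variables is indexed by \<^typ>\<open>nat\<close>.\<close>

datatype form =
    Var nat
  | Top
  | Bot
  | Neg form
  | Circ form
  | And form form
  | Or form form

primrec subformulas :: "form \<Rightarrow> form set" where
  "subformulas (Var x) = {Var x}"
| "subformulas Top = {Top}"
| "subformulas Bot = {Bot}"
| "subformulas (Neg a) = insert (Neg a) (subformulas a)"
| "subformulas (Circ a) = insert (Circ a) (subformulas a)"
| "subformulas (And a b) = insert (And a b) (subformulas a \<union> subformulas b)"
| "subformulas (Or a b) = insert (Or a b) (subformulas a \<union> subformulas b)"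

definition sub :: "form set \<Rightarrow> form set" where
  "sub \<Phi> = (\<Union>a\<in>\<Phi>. subformulas a)"

primrec subst :: "(nat \<Rightarrow> form) \<Rightarrow> form \<Rightarrow> form" where
  "subst \<sigma> (Var x) = \<sigma> x"
| "subst \<sigma> Top = Top"
| "subst \<sigma> Bot = Bot"
| "subst \<sigma> (Neg a) = Neg (subst \<sigma> a)"
| "subst \<sigma> (Circ a) = Circ (subst \<sigma> a)"
| "subst \<sigma> (And a b) = And (subst \<sigma> a) (subst \<sigma> b)"
| "subst \<sigma> (Or a b) = Or (subst \<sigma> a) (subst \<sigma> b)"


section \<open>Perfect paradefinite algebras\<close>

record 'a alg =
  carrier :: "'a set"
  meet :: "'a \<Rightarrow> 'a \<Rightarrow> 'a"
  join :: "'a \<Rightarrow> 'a \<Rightarrow> 'a"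
  neg :: "'a \<Rightarrow> 'a"
  circ :: "'a \<Rightarrow> 'a"
  top_el :: 'a
  bot_el :: 'a

locale alg_signature =
  fixes A :: "'a alg" (structure)
  assumes meet_closed: "\<lbrakk>x \<in> carrier A; y \<in> carrier A\<rbrakk> \<Longrightarrow> meet A x y \<in> carrier A"
    and join_closed: "\<lbrakk>x \<in> carrier A; y \<in> carrier A\<rbrakk> \<Longrightarrow> join A x y \<in> carrier A"
    and neg_closed: "x \<in> carrier A \<Longrightarrow> neg A x \<in> carrier A"
    and circ_closed: "x \<in> carrier A \<Longrightarrow> circ A x \<in> carrier A"
    and top_closed: "top_el A \<in> carrier A"
    and bot_closed: "bot_el A \<in> carrier A"

locale bounded_distributive_lattice = alg_signature +
  assumes meet_assoc: "\<lbrakk>x \<in> carrier A; y \<in> carrier A; z \<in> carrier A\<rbrakk>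
      \<Longrightarrow> meet A (meet A x y) z = meet A x (meet A y z)"
    and join_assoc: "\<lbrakk>x \<in> carrier A; y \<in> carrier A; z \<in> carrier A\<rbrakk>
      \<Longrightarrow> join A (join A x y) z = join A x (join A y z)"
    and meet_comm: "\<lbrakk>x \<in> carrier A; y \<in> carrier A\<rbrakk> \<Longrightarrow> meet A x y = meet A y x"
    and join_comm: "\<lbrakk>x \<in> carrier A; y \<in> carrier A\<rbrakk> \<Longrightarrow> join A x y = join A y x"
    and meet_join_absorb: "\<lbrakk>x \<in> carrier A; y \<in> carrier A\<rbrakk> \<Longrightarrow> meet A x (join A x y) = x"
    and join_meet_absorb: "\<lbrakk>x \<in> carrier A; y \<in> carrier A\<rbrakk> \<Longrightarrow> join A x (meet A x y) = x"
    and meet_join_distrib: "\<lbrakk>x \<in> carrier A; y \<in> carrier A; z \<in> carrier A\<rbrakk>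
      \<Longrightarrow> meet A x (join A y z) = join A (meet A x y) (meet A x z)"
    and meet_top: "x \<in> carrier A \<Longrightarrow> meet A x (top_el A) = x"
    and join_bot: "x \<in> carrier A \<Longrightarrow> join A x (bot_el A) = x"

locale de_morgan_algebra = bounded_distributive_lattice +
  assumes neg_neg: "x \<in> carrier A \<Longrightarrow> neg A (neg A x) = x"
    and neg_meet: "\<lbrakk>x \<in> carrier A; y \<in> carrier A\<rbrakk>
      \<Longrightarrow> neg A (meet A x y) = join A (neg A x) (neg A y)"

locale pp_algebra = de_morgan_algebra +
  assumes circ_circ: "x \<in> carrier A \<Longrightarrow> circ A (circ A x) = top_el A"
    and circ_neg: "x \<in> carrier A \<Longrightarrow> circ A x = circ A (neg A x)"
    and circ_top: "circ A (top_el A) = top_el A"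
    and meet_neg_circ: "x \<in> carrier A \<Longrightarrow> meet A (meet A x (neg A x)) (circ A x) = bot_el A"
    and circ_meet: "\<lbrakk>x \<in> carrier A; y \<in> carrier A\<rbrakk> \<Longrightarrow>
      circ A (meet A x y) =
        meet A (meet A (join A (circ A x) (circ A y)) (join A (circ A x) (neg A y)))
          (join A (circ A y) (neg A x))"

primrec eval :: "'a alg \<Rightarrow> (nat \<Rightarrow> 'a) \<Rightarrow> form \<Rightarrow> 'a" where
  "eval A v (Var x) = v x"
| "eval A v Top = top_el A"
| "eval A v Bot = bot_el A"
| "eval A v (Neg a) = neg A (eval A v a)"
| "eval A v (Circ a) = circ A (eval A v a)"
| "eval A v (And a b) = meet A (eval A v a) (eval A v b)"
| "eval A v (Or a b) = join A (eval A v a) (eval A v b)"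


section \<open>The order-preserving logic\<close>

text \<open>
  HOL cannot quantify over types inside a formula, so ``all PP-algebras'' are here all those whose
  carrier is a subset of the type \<^typ>\<open>'a\<close>. Results about this notion are to be stated for
  an arbitrary infinite type \<^typ>\<open>'a\<close>; this covers algebras of every cardinality.
\<close>

definition pp_valid :: "'a itself \<Rightarrow> form \<Rightarrow> form \<Rightarrow> bool" where
  "pp_valid _ a b \<longleftrightarrow>
    (\<forall>(A :: 'a alg) v. pp_algebra A \<longrightarrow> (\<forall>x. v x \<in> carrier A) \<longrightarrow> eval A v a = eval A v b)"

definition big_and :: "form list \<Rightarrow> form" where
  "big_and as = foldr And as Top"

definition big_or :: "form list \<Rightarrow> form" where
  "big_or as = foldr Or as Bot"

text \<open>
  The finite subsets of \<open>\<Phi>\<close> and \<open>\<Psi>\<close> are given by enumerations; in a lattice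
  the value of a finite meet or join does not depend on the enumeration.
\<close>

definition pp_consequence :: "'a itself \<Rightarrow> form set \<Rightarrow> form set \<Rightarrow> bool" where
  "pp_consequence T \<Phi> \<Psi> \<longleftrightarrow>
    (\<exists>as bs. set as \<subseteq> \<Phi> \<and> set bs \<subseteq> \<Psi> \<and>
      pp_valid T (big_and as) (And (big_and as) (big_or bs)))"


section \<open>Rooted trees\<close>

text \<open>
  A tree is given by the reflexive partial order \<open>r\<close> of its nodes, with the root at the
  bottom; the set of nodes is \<^term>\<open>Field r\<close>, and the (proper) ancestors of a node
  \<open>n\<close> are the elements of \<^term>\<open>underS r n\<close>.
\<close>

definition is_root :: "'n rel \<Rightarrow> 'n \<Rightarrow> bool" where
  "is_root r n \<longleftrightarrow> n \<in> Field r \<and> (\<forall>m\<in>Field r. (n, m) \<in> r)"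

definition rooted_tree :: "'n rel \<Rightarrow> bool" where
  "rooted_tree r \<longleftrightarrow>
    partial_order_on (Field r) r \<and>
    (\<exists>n. is_root r n) \<and>
    (\<forall>n\<in>Field r. well_order_on (underS r n) (Restr r (underS r n)))"

definition is_leaf :: "'n rel \<Rightarrow> 'n \<Rightarrow> bool" where
  "is_leaf r n \<longleftrightarrow> n \<in> Field r \<and> aboveS r n = {}"

definition children :: "'n rel \<Rightarrow> 'n \<Rightarrow> 'n set" where
  "children r n = {m \<in> aboveS r n. aboveS r n \<inter> underS r m = {}}"

definition is_branch :: "'n rel \<Rightarrow> 'n set \<Rightarrow> bool" where
  "is_branch r B \<longleftrightarrow> B \<in> Chains r \<and> (\<forall>C\<in>Chains r. B \<subseteq> C \<longrightarrow> C = B)"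


section \<open>Symmetrical calculi\<close>

type_synonym rule = "form set \<times> form set"

datatype label = Star | Fmlas "form set"

text \<open>
  The order of a rooted tree may contain limit nodes, that is, nodes other than the root that are
  not the child of any node. The last conjunct says that such a node carries exactly the formulas
  accumulated along its ancestors. Without it, limit nodes could be labelled arbitrarily, and
  everything would be derivable: an \<open>\<omega>\<close>-chain of applications of any axiom
  could be topped by a leaf labelled \<^const>\<open>Star\<close>.
  Trees of finite height have no limit nodes.
\<close>

definition derivation :: "rule set \<Rightarrow> 'n rel \<Rightarrow> ('n \<Rightarrow> label) \<Rightarrow> bool" where
  "derivation R r l \<longleftrightarrow>
    rooted_tree r \<and>
    (\<forall>B. is_branch r B \<longrightarrow> (\<exists>n\<in>B. is_leaf r n)) \<and>
    (\<forall>n\<in>Field r. \<not> is_leaf r n \<longrightarrow>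
      (\<exists>\<Gamma> \<Pi> \<Theta> \<sigma>. l n = Fmlas \<Gamma> \<and> (\<Pi>, \<Theta>) \<in> R \<and> subst \<sigma> ` \<Pi> \<subseteq> \<Gamma> \<and>
        (if \<Theta> = {} then (\<exists>m. children r n = {m} \<and> l m = Star)
         else (\<exists>c. bij_betw c (subst \<sigma> ` \<Theta>) (children r n) \<and>
                (\<forall>a\<in>subst \<sigma> ` \<Theta>. l (c a) = Fmlas (insert a \<Gamma>)))))) \<and>
    (\<forall>n\<in>Field r. \<not> is_root r n \<and> (\<forall>m\<in>Field r. n \<notin> children r m) \<longrightarrow>
      l n = Fmlas (\<Union>{\<Gamma>. \<exists>m\<in>underS r n. l m = Fmlas \<Gamma>}))"

text \<open>
  The derivation trees have their nodes in the type \<^typ>\<open>'n\<close>. As with the carriers of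
  algebras above, results are to be stated for an arbitrary infinite type \<^typ>\<open>'n\<close>.
\<close>

definition derives_within ::
    "'n itself \<Rightarrow> rule set \<Rightarrow> form set \<Rightarrow> form set \<Rightarrow> form set \<Rightarrow> bool" where
  "derives_within _ R \<Lambda> \<Phi> \<Psi> \<longleftrightarrow>
    (\<exists>(r :: 'n rel) l. derivation R r l \<and>
      (\<exists>n \<Gamma>. is_root r n \<and> l n = Fmlas \<Gamma> \<and> \<Gamma> \<subseteq> \<Phi>) \<and>
      (\<forall>n. is_leaf r n \<longrightarrow> l n = Star \<or> (\<exists>\<Gamma>. l n = Fmlas \<Gamma> \<and> \<Gamma> \<inter> \<Psi> \<noteq> {})) \<and>
      (\<forall>n\<in>Field r. \<forall>\<Gamma>. l n = Fmlas \<Gamma> \<longrightarrow> \<Gamma> \<subseteq> \<Lambda>))"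

definition derives :: "'n itself \<Rightarrow> rule set \<Rightarrow> form set \<Rightarrow> form set \<Rightarrow> bool" where
  "derives T R \<Phi> \<Psi> \<longleftrightarrow> derives_within T R UNIV \<Phi> \<Psi>"

definition generalized_subformulas :: "form set \<Rightarrow> form set \<Rightarrow> form set" where
  "generalized_subformulas \<Xi> \<Phi> =
    sub \<Phi> \<union> {subst \<sigma> a | \<sigma> a. a \<in> \<Xi> \<and> (\<forall>x. \<sigma> x \<in> sub \<Phi>)}"

definition analytic :: "'n itself \<Rightarrow> form set \<Rightarrow> rule set \<Rightarrow> bool" where
  "analytic T \<Xi> R \<longleftrightarrow>
    (\<forall>\<Phi> \<Psi>. derives T R \<Phi> \<Psi> \<longrightarrow>
      derives_within T R (generalized_subformulas \<Xi> (\<Phi> \<union> \<Psi>)) \<Phi> \<Psi>)"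


section \<open>The rules\<close>

definition R_B :: "rule set" where
  "R_B = (let p = Var 0; q = Var 1 in
   {({}, {Top}),
    ({Neg Top}, {}),
    ({}, {Neg Bot}),
    ({Bot}, {}),
    ({p}, {Neg (Neg p)}),
    ({Neg (Neg p)}, {p}),
    ({And p q}, {p}),
    ({And p q}, {q}),
    ({p, q}, {And p q}),
    ({Neg p}, {Neg (And p q)}),
    ({Neg q}, {Neg (And p q)}),
    ({Neg (And p q)}, {Neg p, Neg q}),
    ({p}, {Or p q}),
    ({q}, {Or p q}),
    ({Or p q}, {p, q}),
    ({Neg p, Neg q}, {Neg (Or p q)}),
    ({Neg (Or p q)}, {Neg p}),
    ({Neg (Or p q)}, {Neg q})})"

definition R_circ :: "rule set" where
  "R_circ = (let p = Var 0; q = Var 1 in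
   {({}, {Circ Bot}),
    ({}, {Circ Top}),
    ({}, {Circ (Circ p)}),
    ({Circ p}, {Circ (Neg p)}),
    ({Circ (Neg p)}, {Circ p}),
    ({Circ p}, {p, Neg p}),
    ({Circ p, p, Neg p}, {}),
    ({Circ p}, {Circ (And p q), p}),
    ({Circ q}, {Circ (And p q), q}),
    ({Circ (And p q), q}, {Circ p}),
    ({Circ (And p q), p}, {Circ q}),
    ({Circ p, Circ q}, {Circ (And p q)}),
    ({Circ (And p q)}, {Circ p, Circ q}),
    ({Circ p, Circ q}, {Circ (Or p q)}),
    ({Circ (Or p q)}, {Circ p, Circ q}),
    ({Circ p, p}, {Circ (Or p q)}),
    ({Circ q, q}, {Circ (Or p q)}),
    ({Circ (Or p q)}, {Circ p, q}),
    ({Circ (Or p q)}, {Circ q, p})})"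

definition S :: "form set" where
  "S = (let p = Var 0 in {p, Neg p})"

definition S_circ :: "form set" where
  "S_circ = (let p = Var 0 in S \<union> {Neg p, Circ p, Neg (Circ p)})"

end

theory Submission
  imports Defs "HOL-Library.Countable" "HOL-Library.Sublist"
begin

text \<open>
  Both halves of the theorem follow from two implications: derivability implies consequence
  (\<open>derives_imp_pp_consequence\<close>), and consequence implies derivability by a tree in which
  only generalized subformulas occur (\<open>pp_consequence_imp_derives_within\<close>). Going around
  the circle turns an arbitrary derivation into an analytic one. In both directions the link between
  calculus and semantics is a set \<open>T\<close> of formulas that is \<^emph>\<open>saturated\<close>: whenever
  it contains the premises of a rule instance, it contains one of the conclusions.

  \<^emph>\<open>Soundness.\<close> If \<open>\<Psi>\<close> does not follow from \<open>\<Phi>\<close>, Zorn's lemma gives a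
  maximal \<open>T \<supseteq> \<Phi>\<close> from which \<open>\<Psi>\<close> does not follow. By cut, \<open>T\<close> is a prime
  theory, that is, it behaves like a prime filter of the Lindenbaum algebra. Each defining equation
  of PP-algebras then becomes a Boolean constraint on membership in \<open>T\<close>, and these
  constraints make \<open>T\<close> saturated. In a derivation from \<open>\<Phi>\<close> one can now climb from the
  root through nodes whose formulas all lie in \<open>T\<close>. The climb passes limit nodes, whose
  labels are unions of earlier ones, and can stop only at a leaf. Such a leaf is not labelled
  \<^const>\<open>Star\<close>, so it contains an element of \<open>\<Psi>\<close>, which is impossible if
  \<open>T\<close> avoids \<open>\<Psi>\<close>.

  \<^emph>\<open>Completeness with analyticity.\<close> Only finitely many formulas matter, so the set
  \<open>\<Lambda>\<close> of their generalized subformulas is finite. If no finite derivation inside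
  \<open>\<Lambda>\<close> exists, a maximal unprovable \<open>T \<subseteq> \<Lambda>\<close> above the premises is saturated for the
  rule instances with conclusions in \<open>\<Lambda>\<close>. The three bits
  \<open>a \<in> T\<close>, \<open>\<sim>a \<in> T\<close>, \<open>\<circ>a \<in> T\<close> tell which element of the
  six-element PP-algebra \<open>a\<close> denotes. The formulas \<open>\<sim>a\<close>, \<open>\<circ>a\<close>
  and \<open>\<sim>\<circ>a\<close> that are added to the subformulas are those whose membership in
  \<open>T\<close> is needed to check that this assignment is a homomorphism on subformulas
  (\<open>eval_theory_value\<close>). It refutes the consequence.
\<close>


section \<open>The lattice order of an algebra\<close>

definition below :: "'a alg \<Rightarrow> 'a \<Rightarrow> 'a \<Rightarrow> bool" where
  "below A x y \<longleftrightarrow> meet A x y = x"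

context alg_signature
begin

lemma eval_closed: "(\<And>x. v x \<in> carrier A) \<Longrightarrow> eval A v a \<in> carrier A"
  by (induction a) (auto intro: meet_closed join_closed neg_closed circ_closed top_closed bot_closed)

end

context bounded_distributive_lattice
begin

lemmas closed = meet_closed join_closed neg_closed circ_closed top_closed bot_closed

lemma below_refl: "x \<in> carrier A \<Longrightarrow> below A x x"
  unfolding below_def
  using meet_join_absorb[of x "meet A x x"] join_meet_absorb[of x x] closed by simp

lemma below_trans:
  "\<lbrakk>x \<in> carrier A; y \<in> carrier A; z \<in> carrier A; below A x y; below A y z\<rbrakk> \<Longrightarrow> below A x z"
  unfolding below_def by (metis meet_assoc)

lemma below_meet_iff:
  assumes "x \<in> carrier A" "y \<in> carrier A" "z \<in> carrier A"
  shows "below A z (meet A x y) \<longleftrightarrow> below A z x \<and> below A z y"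
proof
  assume "below A z (meet A x y)"
  moreover have "below A (meet A x y) x" "below A (meet A x y) y"
    using assms below_refl unfolding below_def by (metis meet_assoc meet_comm meet_closed)+
  ultimately show "below A z x \<and> below A z y"
    using assms closed by (meson below_trans)
next
  assume "below A z x \<and> below A z y"
  then show "below A z (meet A x y)"
    using assms unfolding below_def by (metis meet_assoc)
qed

lemma below_iff_join:
  assumes "x \<in> carrier A" "y \<in> carrier A"
  shows "below A x y \<longleftrightarrow> join A x y = y"
  using assms unfolding below_def by (metis join_comm join_meet_absorb meet_comm meet_join_absorb)

lemma join_below_iff:
  assumes "x \<in> carrier A" "y \<in> carrier A" "z \<in> carrier A"
  shows "below A (join A x y) z \<longleftrightarrow> below A x z \<and> below A y z"
proof
  assume "below A (join A x y) z"
  moreover have "below A x (join A x y)" "below A y (join A x y)"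
    using assms unfolding below_def by (metis join_comm meet_join_absorb)+
  ultimately show "below A x z \<and> below A y z"
    using assms closed by (meson below_trans)
next
  assume "below A x z \<and> below A y z"
  then show "below A (join A x y) z"
    using assms closed by (simp add: below_iff_join join_assoc)
qed

lemma below_join:
  assumes "x \<in> carrier A" "y \<in> carrier A"
  shows "below A x (join A x y)" "below A y (join A x y)"
  using assms closed join_below_iff[of x y "join A x y"] below_refl by auto

lemma meet_below:
  assumes "x \<in> carrier A" "y \<in> carrier A"
  shows "below A (meet A x y) x" "below A (meet A x y) y"
  using assms closed below_meet_iff[of x y "meet A x y"] below_refl by auto

lemma below_top: "x \<in> carrier A \<Longrightarrow> below A x (top_el A)"
  unfolding below_def by (rule meet_top)

lemma bot_below: "x \<in> carrier A \<Longrightarrow> below A (bot_el A) x"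
  by (simp add: below_iff_join closed join_comm[of "bot_el A"] join_bot)

text \<open>
  The algebraic form of cut: by distributivity \<open>x\<close> is the join of \<open>x \<and> y\<close> and
  \<open>x \<and> c\<close>, and both are below \<open>y\<close>.
\<close>

lemma below_cut:
  assumes "x \<in> carrier A" "y \<in> carrier A" "c \<in> carrier A"
    and "below A x (join A y c)" "below A (meet A x c) y"
  shows "below A x y"
proof -
  have "x = join A (meet A x y) (meet A x c)"
    using assms by (metis below_def meet_join_distrib)
  moreover have "below A (join A (meet A x y) (meet A x c)) y"
    using assms closed meet_below by (simp add: join_below_iff)
  ultimately show ?thesis by simp
qed

lemma below_big_and_iff:
  assumes "\<And>x. v x \<in> carrier A" "z \<in> carrier A"
  shows "below A z (eval A v (big_and as)) \<longleftrightarrow> (\<forall>a\<in>set as. below A z (eval A v a))"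
  using assms(2)
  by (induction as) (auto simp: big_and_def below_top below_meet_iff eval_closed[OF assms(1)])

lemma big_or_below_iff:
  assumes "\<And>x. v x \<in> carrier A" "z \<in> carrier A"
  shows "below A (eval A v (big_or as)) z \<longleftrightarrow> (\<forall>a\<in>set as. below A (eval A v a) z)"
  using assms(2)
  by (induction as) (auto simp: big_or_def bot_below join_below_iff eval_closed[OF assms(1)])

end

context de_morgan_algebra
begin

lemma neg_top: "neg A (top_el A) = bot_el A"
proof -
  have "join A x (neg A (top_el A)) = x" if "x \<in> carrier A" for x
    using neg_meet[of "neg A x" "top_el A"] that closed by (simp add: neg_neg meet_top)
  then show ?thesis
    using closed by (metis join_bot join_comm)
qed

lemma neg_bot: "neg A (bot_el A) = top_el A"
  using neg_top neg_neg closed by metis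

lemma neg_join:
  "\<lbrakk>x \<in> carrier A; y \<in> carrier A\<rbrakk> \<Longrightarrow> neg A (join A x y) = meet A (neg A x) (neg A y)"
  using neg_meet[of "neg A x" "neg A y"] closed by (metis neg_neg)

end


section \<open>Cut and prime theories for the order-preserving logic\<close>

lemma pp_consequence_iff:
  "pp_consequence TYPE('a) \<Phi> \<Psi> \<longleftrightarrow>
    (\<exists>as bs. set as \<subseteq> \<Phi> \<and> set bs \<subseteq> \<Psi> \<and>
      (\<forall>(A :: 'a alg) v. pp_algebra A \<longrightarrow> (\<forall>x. v x \<in> carrier A) \<longrightarrow>
        below A (eval A v (big_and as)) (eval A v (big_or bs))))"
  unfolding pp_consequence_def pp_valid_def below_def by (simp add: eq_commute)

text \<open>
  The cut formula \<open>c\<close> may occur in the two enumerations of \<open>insert c\<close>, so it is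
  filtered out before they are concatenated. What remains is \<open>below_cut\<close>, applied in each
  algebra to the meet of all premises and the join of all conclusions.
\<close>

lemma pp_consequence_cut:
  assumes "pp_consequence TYPE('a) \<Gamma> (insert c \<Delta>)"
    and "pp_consequence TYPE('a) (insert c \<Gamma>) \<Delta>"
  shows "pp_consequence TYPE('a) \<Gamma> \<Delta>"
proof -
  obtain as1 bs1 where 1: "set as1 \<subseteq> \<Gamma>" "set bs1 \<subseteq> insert c \<Delta>"
    "\<And>(A :: 'a alg) v. pp_algebra A \<Longrightarrow> (\<forall>x. v x \<in> carrier A) \<Longrightarrow>
        below A (eval A v (big_and as1)) (eval A v (big_or bs1))"
    using assms(1) unfolding pp_consequence_iff by metis
  obtain as2 bs2 where 2: "set as2 \<subseteq> insert c \<Gamma>" "set bs2 \<subseteq> \<Delta>"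
    "\<And>(A :: 'a alg) v. pp_algebra A \<Longrightarrow> (\<forall>x. v x \<in> carrier A) \<Longrightarrow>
        below A (eval A v (big_and as2)) (eval A v (big_or bs2))"
    using assms(2) unfolding pp_consequence_iff by metis
  define as where "as = as1 @ filter (\<lambda>a. a \<noteq> c) as2"
  define bs where "bs = filter (\<lambda>b. b \<noteq> c) bs1 @ bs2"
  have "below A (eval A v (big_and as)) (eval A v (big_or bs))"
    if A: "pp_algebra A" and v: "\<forall>x. v x \<in> carrier A" for A :: "'a alg" and v
  proof -
    interpret pp_algebra A by fact
    have v': "\<And>x. v x \<in> carrier A" using v by simp
    note ev = eval_closed[of v, OF v']
    note and_iff = below_big_and_iff[of v, OF v'] and or_iff = big_or_below_iff[of v, OF v']
    let ?e = "eval A v"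
    let ?x = "?e (big_and as)" and ?y = "?e (big_or bs)"
    have x: "below A ?x (?e a)" if "a \<in> set as" for a
      using and_iff[OF ev, where as = as] below_refl[OF ev] that by blast
    have y: "below A (?e b) ?y" if "b \<in> set bs" for b
      using or_iff[OF ev, where as = bs] below_refl[OF ev] that by blast
    have "below A ?x (?e (big_and as1))"
      unfolding and_iff[OF ev] using x as_def by auto
    moreover have "below A (?e (big_or bs1)) (join A ?y (?e c))"
      unfolding or_iff[OF join_closed[OF ev ev]]
    proof
      fix b assume b: "b \<in> set bs1"
      show "below A (?e b) (join A ?y (?e c))"
      proof (cases "b = c")
        case True
        then show ?thesis using below_join ev by blast
      next
        case False
        then have "below A (?e b) ?y" using b bs_def y by auto
        then show ?thesis using below_join(1)[OF ev ev] below_trans[OF ev ev join_closed[OF ev ev]] by blast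
      qed
    qed
    ultimately have a: "below A ?x (join A ?y (?e c))"
      using 1(3)[OF A v] below_trans ev join_closed by meson
    have "below A (meet A ?x (?e c)) (?e (big_and as2))"
      unfolding and_iff[OF meet_closed[OF ev ev]]
    proof
      fix b assume b: "b \<in> set as2"
      show "below A (meet A ?x (?e c)) (?e b)"
      proof (cases "b = c")
        case True
        then show ?thesis using meet_below ev by blast
      next
        case False
        then have "below A ?x (?e b)" using b as_def x by auto
        then show ?thesis using meet_below(1)[OF ev ev] below_trans[OF meet_closed[OF ev ev] ev ev] by blast
      qed
    qed
    moreover have "below A (?e (big_or bs2)) ?y"
      unfolding or_iff[OF ev] using y bs_def by auto
    ultimately have b: "below A (meet A ?x (?e c)) ?y"
      using 2(3)[OF A v] below_trans ev meet_closed by meson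
    show ?thesis using below_cut[OF ev ev ev a b] .
  qed
  moreover have "set as \<subseteq> \<Gamma>" "set bs \<subseteq> \<Delta>"
    using 1 2 unfolding as_def bs_def by auto
  ultimately show ?thesis unfolding pp_consequence_iff by blast
qed

lemma pp_consequence_mono:
  "\<lbrakk>pp_consequence T \<Phi> \<Psi>; \<Phi> \<subseteq> \<Phi>'; \<Psi> \<subseteq> \<Psi>'\<rbrakk> \<Longrightarrow> pp_consequence T \<Phi>' \<Psi>'"
  unfolding pp_consequence_def by (meson order_trans)

lemma pp_consequence_cut_finite:
  assumes "finite Y" "pp_consequence TYPE('a) \<Gamma> (Y \<union> \<Delta>)"
    and "\<And>y. y \<in> Y \<Longrightarrow> pp_consequence TYPE('a) (insert y \<Gamma>) \<Delta>"
  shows "pp_consequence TYPE('a) \<Gamma> \<Delta>"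
  using assms
proof (induction Y)
  case (insert y Y)
  have "pp_consequence TYPE('a) (insert y \<Gamma>) (Y \<union> \<Delta>)"
    using insert.prems(2)[of y] by (rule pp_consequence_mono) auto
  then have "pp_consequence TYPE('a) \<Gamma> (Y \<union> \<Delta>)"
    using insert.prems(1) pp_consequence_cut by auto
  then show ?case using insert by blast
qed simp

text \<open>
  A formulation of prime filters of the Lindenbaum algebra in terms of sequents. Taking
  \<open>Y\<close> a singleton gives deductive closure, \<open>Y = {}\<close> consistency, and two-element
  \<open>Y\<close> primeness.
\<close>

definition prime_theory :: "'a itself \<Rightarrow> form set \<Rightarrow> bool" where
  "prime_theory t T \<longleftrightarrow> (\<forall>X Y. X \<subseteq> T \<longrightarrow> pp_consequence t X Y \<longrightarrow> Y \<inter> T \<noteq> {})"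

text \<open>
  A maximal \<open>T\<close> from which \<open>\<Psi>\<close> does not follow exists because consequence is finitary.
  If it missed all of \<open>Y\<close> although \<open>Y\<close> follows from part of it, then adding any
  \<open>y \<in> Y\<close> would make \<open>\<Psi>\<close> follow, and cut would yield \<open>\<Psi>\<close> from \<open>T\<close> itself.
\<close>

lemma prime_theory_extension:
  assumes "\<not> pp_consequence TYPE('a) \<Phi> \<Psi>"
  obtains T where "prime_theory TYPE('a) T" "\<Phi> \<subseteq> T" "T \<inter> \<Psi> = {}"
proof -
  let ?F = "{T. \<Phi> \<subseteq> T \<and> \<not> pp_consequence TYPE('a) T \<Psi>}"
  have "\<exists>T\<in>?F. \<forall>X\<in>?F. T \<subseteq> X \<longrightarrow> X = T"
  proof (rule subset_Zorn_nonempty)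
    show "?F \<noteq> {}" using assms by blast
  next
    fix C assume C: "C \<noteq> {}" "subset.chain ?F C"
    have "\<not> pp_consequence TYPE('a) (\<Union>C) \<Psi>"
    proof
      assume "pp_consequence TYPE('a) (\<Union>C) \<Psi>"
      then obtain as bs where as: "set as \<subseteq> \<Union>C" "set bs \<subseteq> \<Psi>"
        "pp_valid TYPE('a) (big_and as) (And (big_and as) (big_or bs))"
        unfolding pp_consequence_def by blast
      obtain X where "X \<in> C" "set as \<subseteq> X"
        using finite_subset_Union_chain[OF _ as(1) C] by blast
      then show False
        using as C(2) unfolding pp_consequence_def subset.chain_def by blast
    qed
    then show "\<Union>C \<in> ?F" using C unfolding subset.chain_def by blast
  qed
  then obtain T where TF: "T \<in> ?F" and maximal: "\<forall>X\<in>?F. T \<subseteq> X \<longrightarrow> X = T" by (rule bexE)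
  from TF have T: "\<Phi> \<subseteq> T" "\<not> pp_consequence TYPE('a) T \<Psi>" by simp_all
  have T_max: "pp_consequence TYPE('a) X \<Psi>" if "T \<subset> X" for X
  proof (rule ccontr)
    assume "\<not> pp_consequence TYPE('a) X \<Psi>"
    then have "X \<in> ?F" using that T(1) by auto
    then have "X = T" using maximal that by simp
    then show False using that by simp
  qed
  have "prime_theory TYPE('a) T"
    unfolding prime_theory_def
  proof (intro allI impI notI)
    fix X Y assume X: "X \<subseteq> T" "pp_consequence TYPE('a) X Y" "Y \<inter> T = {}"
    from X(2) obtain as bs where "set as \<subseteq> X" and bs: "set bs \<subseteq> Y"
        and "pp_valid TYPE('a) (big_and as) (And (big_and as) (big_or bs))"
      unfolding pp_consequence_def by blast
    then have bs_conseq: "pp_consequence TYPE('a) X (set bs)"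
      unfolding pp_consequence_def by (intro exI[of _ as] exI[of _ bs]) simp
    have "pp_consequence TYPE('a) T (set bs \<union> \<Psi>)"
      using bs_conseq X(1) by (rule pp_consequence_mono) auto
    moreover have "pp_consequence TYPE('a) (insert y T) \<Psi>" if "y \<in> set bs" for y
      using that bs X(3) by (intro T_max) blast
    ultimately show False
      using T(2) pp_consequence_cut_finite by blast
  qed
  moreover have "T \<inter> \<Psi> = {}"
  proof (rule ccontr)
    assume "T \<inter> \<Psi> \<noteq> {}"
    then obtain a where a: "a \<in> T" "a \<in> \<Psi>" by blast
    have "pp_consequence TYPE('a) {a} {a}"
      unfolding pp_consequence_iff
    proof (intro exI[of _ "[a]"] conjI allI impI)
      fix A :: "'a alg" and v :: "nat \<Rightarrow> 'a" assume A: "pp_algebra A" and v: "\<forall>x. v x \<in> carrier A"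
      interpret pp_algebra A by fact
      show "below A (eval A v (big_and [a])) (eval A v (big_or [a]))"
        using eval_closed[of v] v
        by (simp add: big_and_def big_or_def meet_top join_bot below_refl)
    qed auto
    then have "pp_consequence TYPE('a) T \<Psi>"
      by (rule pp_consequence_mono) (use a in auto)
    then show False using T(2) by simp
  qed
  ultimately show thesis using that T(1) by blast
qed


section \<open>Soundness of the rules\<close>

text \<open>
  The relativization to \<open>\<Lambda>\<close> serves two purposes: with \<^term>\<open>UNIV\<close> it expresses
  soundness of the rules for a theory, and with a finite \<open>\<Lambda>\<close> it is what maximality
  yields for derivations that may only use formulas of \<open>\<Lambda>\<close>. Restricting the conclusions
  is enough because the premises already lie in \<open>T\<close>.
\<close>

definition saturated :: "rule set \<Rightarrow> form set \<Rightarrow> form set \<Rightarrow> bool" where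
  "saturated R \<Lambda> T \<longleftrightarrow> (\<forall>(\<Pi>, \<Theta>)\<in>R. \<forall>\<sigma>.
    subst \<sigma> ` \<Pi> \<subseteq> T \<longrightarrow> subst \<sigma> ` \<Theta> \<subseteq> \<Lambda> \<longrightarrow> subst \<sigma> ` \<Theta> \<inter> T \<noteq> {})"

lemma saturatedI:
  assumes "\<And>\<Pi> \<Theta> \<sigma>. \<lbrakk>(\<Pi>, \<Theta>) \<in> R; subst \<sigma> ` \<Pi> \<subseteq> T; subst \<sigma> ` \<Theta> \<subseteq> \<Lambda>\<rbrakk>
    \<Longrightarrow> subst \<sigma> ` \<Theta> \<inter> T \<noteq> {}"
  shows "saturated R \<Lambda> T"
  unfolding saturated_def by (intro ballI, simp only: split_paired_all prod.case, intro allI impI) (rule assms)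

lemma saturatedD:
  "\<lbrakk>saturated R \<Lambda> T; (\<Pi>, \<Theta>) \<in> R; subst \<sigma> ` \<Pi> \<subseteq> T; subst \<sigma> ` \<Theta> \<subseteq> \<Lambda>\<rbrakk>
    \<Longrightarrow> subst \<sigma> ` \<Theta> \<inter> T \<noteq> {}"
  unfolding saturated_def by (drule (1) bspec) simp

text \<open>
  The only way in which PP-algebras enter the study of prime theories: an inequality that holds in
  all of them can be read as a clause on membership.
\<close>

lemma prime_theory_sequent:
  assumes "prime_theory TYPE('a) T"
    and "\<And>(A :: 'a alg) v. \<lbrakk>pp_algebra A; \<And>x. v x \<in> carrier A\<rbrakk> \<Longrightarrow>
      below A (eval A v (big_and as)) (eval A v (big_or bs))"
    and "set as \<subseteq> T"
  shows "\<exists>b\<in>set bs. b \<in> T"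
proof -
  have "pp_consequence TYPE('a) (set as) (set bs)"
    unfolding pp_consequence_iff using assms(2) by blast
  then show ?thesis using assms(1,3) unfolding prime_theory_def by blast
qed

lemma prime_theory_lattice:
  assumes T: "prime_theory TYPE('a) T"
  shows "Top \<in> T" "Bot \<notin> T"
    "And a b \<in> T \<longleftrightarrow> a \<in> T \<and> b \<in> T"
    "Or a b \<in> T \<longleftrightarrow> a \<in> T \<or> b \<in> T"
proof -
  have *: "below A (eval A v (big_and as)) (eval A v (big_or bs))"
    if "pp_algebra A" "\<And>x. v x \<in> carrier A"
      "(as, bs) \<in> {([], [Top]), ([Bot], []), ([And a b], [a]), ([And a b], [b]),
        ([a, b], [And a b]), ([a], [Or a b]), ([b], [Or a b]), ([Or a b], [a, b])}"
    for A :: "'a alg" and v as bs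
  proof -
    interpret pp_algebra A by fact
    show ?thesis
      using that(3) eval_closed[of v, OF that(2)]
      by (auto simp: big_and_def big_or_def meet_top join_bot below_refl meet_below below_join closed)
  qed
  have seq: "\<exists>b\<in>set bs. b \<in> T" if "set as \<subseteq> T"
      "(as, bs) \<in> {([], [Top]), ([Bot], []), ([And a b], [a]), ([And a b], [b]),
        ([a, b], [And a b]), ([a], [Or a b]), ([b], [Or a b]), ([Or a b], [a, b])}" for as bs
    by (rule prime_theory_sequent[OF T *[OF _ _ that(2)] that(1)])
  show "Top \<in> T" using seq[of "[]" "[Top]"] by simp
  show "Bot \<notin> T" using seq[of "[Bot]" "[]"] by auto
  show "And a b \<in> T \<longleftrightarrow> a \<in> T \<and> b \<in> T"
    using seq[of "[And a b]" "[a]"] seq[of "[And a b]" "[b]"] seq[of "[a, b]" "[And a b]"]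
    by (simp (no_asm_use)) blast
  show "Or a b \<in> T \<longleftrightarrow> a \<in> T \<or> b \<in> T"
    using seq[of "[Or a b]" "[a, b]"] seq[of "[a]" "[Or a b]"] seq[of "[b]" "[Or a b]"]
    by (simp (no_asm_use)) blast
qed

lemma prime_theory_cong:
  assumes "prime_theory TYPE('a) T"
    and "\<And>(A :: 'a alg) v. \<lbrakk>pp_algebra A; \<And>a. eval A v a \<in> carrier A\<rbrakk> \<Longrightarrow> eval A v a = eval A v b"
  shows "a \<in> T \<longleftrightarrow> b \<in> T"
proof -
  have *: "below A (eval A v (big_and [a'])) (eval A v (big_or [b']))"
    if A: "pp_algebra A" and v: "\<And>x. v x \<in> carrier A" and ab: "(a', b') \<in> {(a, b), (b, a)}"
    for A :: "'a alg" and v a' b'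
  proof -
    interpret pp_algebra A by fact
    note ev = eval_closed[of v, OF v]
    show ?thesis
      using assms(2)[OF A ev] ab ev
      by (auto simp: big_and_def big_or_def meet_top join_bot below_refl)
  qed
  show ?thesis
    using prime_theory_sequent[OF assms(1) *[of _ _ a b]]
      prime_theory_sequent[OF assms(1) *[of _ _ b a]] by auto
qed

lemma prime_theory_neg:
  assumes T: "prime_theory TYPE('a) T"
  shows "Neg Top \<notin> T" "Neg Bot \<in> T" "Neg (Neg a) \<in> T \<longleftrightarrow> a \<in> T"
    "Neg (And a b) \<in> T \<longleftrightarrow> Neg a \<in> T \<or> Neg b \<in> T"
    "Neg (Or a b) \<in> T \<longleftrightarrow> Neg a \<in> T \<and> Neg b \<in> T"
proof -
  note L = prime_theory_lattice[OF T]
  have eqs: "de_morgan_algebra A" if "pp_algebra A" for A :: "'a alg"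
    using that by (simp add: pp_algebra_def)
  note cong = prime_theory_cong[OF T]
  have "Neg Top \<in> T \<longleftrightarrow> Bot \<in> T"
    by (rule cong) (auto dest: eqs simp: de_morgan_algebra.neg_top)
  then show "Neg Top \<notin> T" using L by simp
  have "Neg Bot \<in> T \<longleftrightarrow> Top \<in> T"
    by (rule cong) (auto dest: eqs simp: de_morgan_algebra.neg_bot)
  then show "Neg Bot \<in> T" using L by simp
  show "Neg (Neg a) \<in> T \<longleftrightarrow> a \<in> T"
    by (rule cong) (auto dest: eqs simp: de_morgan_algebra.neg_neg)
  have "Neg (And a b) \<in> T \<longleftrightarrow> Or (Neg a) (Neg b) \<in> T"
    by (rule cong) (auto dest: eqs simp: de_morgan_algebra.neg_meet)
  then show "Neg (And a b) \<in> T \<longleftrightarrow> Neg a \<in> T \<or> Neg b \<in> T" using L by simp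
  have "Neg (Or a b) \<in> T \<longleftrightarrow> And (Neg a) (Neg b) \<in> T"
    by (rule cong) (auto dest: eqs simp: de_morgan_algebra.neg_join)
  then show "Neg (Or a b) \<in> T \<longleftrightarrow> Neg a \<in> T \<and> Neg b \<in> T" using L by simp
qed

text \<open>
  The rule \<open>\<circ>p / p, \<sim>p\<close> needs \<open>\<circ>a\<close> to be a Boolean element. Applying
  \<open>a \<and> \<sim>a \<and> \<circ>a = \<bottom>\<close> to \<open>\<circ>a\<close> instead of \<open>a\<close>, and using
  \<open>\<circ>\<circ>a = \<top>\<close>, shows that \<open>\<circ>a\<close> and \<open>\<sim>\<circ>a\<close> exclude each other; the
  De Morgan dual of the same equation then leaves \<open>a\<close> or \<open>\<sim>a\<close>. The condition for
  disjunctions comes from that for conjunctions, as \<open>\<circ>\<close> does not distinguish a formula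
  from its negation.
\<close>

lemma prime_theory_circ:
  assumes T: "prime_theory TYPE('a) T"
  shows "Circ Top \<in> T" "Circ Bot \<in> T" "Circ (Circ a) \<in> T"
    "Circ (Neg a) \<in> T \<longleftrightarrow> Circ a \<in> T"
    "\<not> (Circ a \<in> T \<and> a \<in> T \<and> Neg a \<in> T)"
    "Circ a \<in> T \<Longrightarrow> a \<in> T \<or> Neg a \<in> T"
    "Circ (And a b) \<in> T \<longleftrightarrow> (Circ a \<in> T \<or> Circ b \<in> T) \<and> (Circ a \<in> T \<or> Neg b \<in> T) \<and>
      (Circ b \<in> T \<or> Neg a \<in> T)"
    "Circ (Or a b) \<in> T \<longleftrightarrow> (Circ a \<in> T \<or> Circ b \<in> T) \<and> (Circ a \<in> T \<or> b \<in> T) \<and>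
      (Circ b \<in> T \<or> a \<in> T)"
proof -
  note L = prime_theory_lattice[OF T] prime_theory_neg[OF T]
  have eqs: "de_morgan_algebra A" if "pp_algebra A" for A :: "'a alg"
    using that by (simp add: pp_algebra_def)
  note cong = prime_theory_cong[OF T]
  have "Circ Top \<in> T \<longleftrightarrow> Top \<in> T"
    by (rule cong) (simp add: pp_algebra.circ_top)
  then show "Circ Top \<in> T" using L by simp
  have "Circ (Circ a) \<in> T \<longleftrightarrow> Top \<in> T" for a
    by (rule cong) (simp add: pp_algebra.circ_circ)
  then show circ: "Circ (Circ a) \<in> T" for a using L by simp
  have neg: "Circ a \<in> T \<longleftrightarrow> Circ (Neg a) \<in> T" for a
    by (rule cong) (use pp_algebra.circ_neg in force)
  then show "Circ (Neg a) \<in> T \<longleftrightarrow> Circ a \<in> T" by simp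
  have "Circ Bot \<in> T \<longleftrightarrow> Circ (Neg Top) \<in> T"
    by (rule cong) (auto dest: eqs simp: de_morgan_algebra.neg_top)
  then show "Circ Bot \<in> T" using neg \<open>Circ Top \<in> T\<close> by simp
  have "And (And a (Neg a)) (Circ a) \<in> T \<longleftrightarrow> Bot \<in> T" for a
    by (rule cong) (use pp_algebra.meet_neg_circ in force)
  then show gentle: "\<not> (Circ a \<in> T \<and> a \<in> T \<and> Neg a \<in> T)" for a using L by auto
  have "Neg (And (And a (Neg a)) (Circ a)) \<in> T \<longleftrightarrow> Neg Bot \<in> T"
    by (rule cong) (use pp_algebra.meet_neg_circ in force)
  then show "a \<in> T \<or> Neg a \<in> T" if "Circ a \<in> T"
    using L that circ[of a] gentle[of "Circ a"] by auto
  have and_iff: "Circ (And a b) \<in> T \<longleftrightarrow> And (And (Or (Circ a) (Circ b)) (Or (Circ a) (Neg b)))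
      (Or (Circ b) (Neg a)) \<in> T" for a b
    by (rule cong) (use pp_algebra.circ_meet in force)
  then show "Circ (And a b) \<in> T \<longleftrightarrow> (Circ a \<in> T \<or> Circ b \<in> T) \<and> (Circ a \<in> T \<or> Neg b \<in> T) \<and>
      (Circ b \<in> T \<or> Neg a \<in> T)" using L by auto
  have "Circ (Neg (Or a b)) \<in> T \<longleftrightarrow> Circ (And (Neg a) (Neg b)) \<in> T"
    by (rule cong) (auto dest: eqs simp: de_morgan_algebra.neg_join)
  then show "Circ (Or a b) \<in> T \<longleftrightarrow> (Circ a \<in> T \<or> Circ b \<in> T) \<and> (Circ a \<in> T \<or> b \<in> T) \<and>
      (Circ b \<in> T \<or> a \<in> T)" using L and_iff neg by auto
qed

text \<open>
  After the previous lemmas have rewritten membership of compound formulas, each rule of the calculus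
  is a propositional tautology about the membership of \<open>p\<close>, \<open>q\<close>, their negations and
  \<open>\<circ>p\<close>, \<open>\<circ>q\<close>, given that \<open>\<circ>p\<close> forces exactly one of \<open>p\<close>,
  \<open>\<sim>p\<close>.
\<close>

lemma prime_theory_saturated:
  assumes "prime_theory TYPE('a) T"
  shows "saturated (R_B \<union> R_circ) \<Lambda> T"
proof -
  have "subst \<sigma> ` \<Theta> \<inter> T \<noteq> {}"
    if "(\<Pi>, \<Theta>) \<in> R_B \<union> R_circ" "subst \<sigma> ` \<Pi> \<subseteq> T" for \<Pi> \<Theta> \<sigma>
  proof -
    have circ: "(Circ a \<in> T \<longrightarrow> a \<in> T \<or> Neg a \<in> T) \<and> \<not> (Circ a \<in> T \<and> a \<in> T \<and> Neg a \<in> T)" for a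
      using prime_theory_circ(5,6)[OF assms] by blast
    show ?thesis
      using circ[of "\<sigma> 0"] circ[of "\<sigma> 1"] that unfolding R_B_def R_circ_def Let_def
      by (elim UnE insertE emptyE; clarsimp simp: prime_theory_lattice[OF assms] prime_theory_neg[OF assms]
          prime_theory_circ(1-4,7,8)[OF assms]; blast)
  qed
  then show ?thesis by (intro saturatedI)
qed


section \<open>Soundness of derivation trees\<close>

lemma chain_extends_to_branch:
  assumes "C \<in> Chains r"
  obtains B where "is_branch r B" "C \<subseteq> B"
proof -
  let ?F = "{D \<in> Chains r. C \<subseteq> D}"
  have "\<exists>B\<in>?F. \<forall>X\<in>?F. B \<subseteq> X \<longrightarrow> X = B"
  proof (rule subset_Zorn_nonempty)
    show "?F \<noteq> {}" using assms by blast
  next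
    fix K assume K: "K \<noteq> {}" "subset.chain ?F K"
    have "\<Union>K \<in> Chains r"
      unfolding Chains_def
    proof (intro CollectI ballI)
      fix x y assume "x \<in> \<Union>K" "y \<in> \<Union>K"
      then obtain X Y where "X \<in> K" "x \<in> X" "Y \<in> K" "y \<in> Y" by blast
      moreover from this have "X \<subseteq> Y \<or> Y \<subseteq> X" "X \<in> Chains r" "Y \<in> Chains r"
        using K(2) unfolding subset.chain_def by blast+
      ultimately show "(x, y) \<in> r \<or> (y, x) \<in> r"
        unfolding Chains_def by blast
    qed
    then show "\<Union>K \<in> ?F" using K unfolding subset.chain_def by blast
  qed
  then obtain B where "B \<in> ?F" "\<forall>X\<in>?F. B \<subseteq> X \<longrightarrow> X = B" by (rule bexE)
  then have "is_branch r B" "C \<subseteq> B" unfolding is_branch_def by auto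
  then show thesis by (rule that)
qed

text \<open>
  Since trees may have infinite height, there is no induction from the leaves to the root. Instead
  Zorn's lemma is applied to the downward closed set \<open>G\<close> of nodes all of whose ancestors,
  including themselves, carry only formulas of \<open>T\<close>. A maximal node of \<open>G\<close> cannot be a
  leaf, as \<open>T\<close> avoids \<open>\<Psi>\<close>, and cannot be an inner node, as saturation provides a child
  in \<open>G\<close>. The substance of the argument is that a chain in \<open>G\<close> has an upper bound
  in \<open>G\<close>: it lies on a branch, hence below a leaf, and the least node above the chain is
  either in the chain or a limit node, whose label is the union of the labels below it.
\<close>

lemma derives_within_sound:
  assumes "derives_within TYPE('n) R \<Lambda> \<Phi> \<Psi>"
    and sat: "saturated R \<Lambda> T" and "\<Phi> \<subseteq> T"
  shows "T \<inter> \<Psi> \<noteq> {}"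
proof
  assume disj: "T \<inter> \<Psi> = {}"
  obtain r :: "'n rel" and l n\<^sub>0 \<Gamma>\<^sub>0 where der: "derivation R r l"
    and root: "is_root r n\<^sub>0" "l n\<^sub>0 = Fmlas \<Gamma>\<^sub>0" "\<Gamma>\<^sub>0 \<subseteq> \<Phi>"
    and leaf: "\<forall>n. is_leaf r n \<longrightarrow> l n = Star \<or> (\<exists>\<Gamma>. l n = Fmlas \<Gamma> \<and> \<Gamma> \<inter> \<Psi> \<noteq> {})"
    and within: "\<forall>n\<in>Field r. \<forall>\<Gamma>. l n = Fmlas \<Gamma> \<longrightarrow> \<Gamma> \<subseteq> \<Lambda>"
    using assms(1) unfolding derives_within_def by (elim exE conjE) (rule that)
  have po: "partial_order_on (Field r) r"
    and wo: "\<And>n. n \<in> Field r \<Longrightarrow> well_order_on (underS r n) (Restr r (underS r n))"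
    using der unfolding derivation_def rooted_tree_def by auto
  have refl: "\<And>n. n \<in> Field r \<Longrightarrow> (n, n) \<in> r" and anti: "\<And>m n. (m, n) \<in> r \<Longrightarrow> (n, m) \<in> r \<Longrightarrow> m = n"
    and trans: "\<And>k m n. (k, m) \<in> r \<Longrightarrow> (m, n) \<in> r \<Longrightarrow> (k, n) \<in> r"
    using po unfolding partial_order_on_def preorder_on_def refl_on_def antisym_def trans_def by blast+
  have fld: "\<And>m n. (m, n) \<in> r \<Longrightarrow> m \<in> Field r \<and> n \<in> Field r" by (auto simp: Field_def)
  have tot: "(x, y) \<in> r \<or> (y, x) \<in> r" if xy: "(x, k) \<in> r" "(y, k) \<in> r" for x y k
  proof (cases "x = k \<or> y = k \<or> x = y")
    case True
    then show ?thesis using xy refl fld by blast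
  next
    case False
    then have "x \<in> underS r k" "y \<in> underS r k" using xy by (auto simp: underS_def)
    then show ?thesis
      using wo[of k] False fld[OF xy(1)]
      unfolding well_order_on_def linear_order_on_def total_on_def by blast
  qed
  define G where "G = {n \<in> Field r. \<forall>m. (m, n) \<in> r \<longrightarrow> (\<exists>\<Gamma>. l m = Fmlas \<Gamma> \<and> \<Gamma> \<subseteq> T)}"
  have G_down: "m \<in> G" if "(m, n) \<in> r" "n \<in> G" for m n
    using that trans fld unfolding G_def by blast
  have G_step: "n \<in> G" if "n \<in> Field r" "\<And>m. m \<in> underS r n \<Longrightarrow> m \<in> G"
    "l n = Fmlas \<Gamma>" "\<Gamma> \<subseteq> T" for n \<Gamma>
  proof -
    have "\<exists>\<Gamma>. l m = Fmlas \<Gamma> \<and> \<Gamma> \<subseteq> T" if m: "(m, n) \<in> r" for m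
    proof (cases "m = n")
      case True
      then show ?thesis using \<open>l n = Fmlas \<Gamma>\<close> \<open>\<Gamma> \<subseteq> T\<close> by blast
    next
      case False
      then have "m \<in> G" using m \<open>\<And>m. m \<in> underS r n \<Longrightarrow> m \<in> G\<close> unfolding underS_def by simp
      then show ?thesis using refl fld m unfolding G_def by simp
    qed
    then show ?thesis using that(1) unfolding G_def by simp
  qed
  have root_le: "\<And>n. n \<in> Field r \<Longrightarrow> (n\<^sub>0, n) \<in> r" and root_fld: "n\<^sub>0 \<in> Field r"
    using root(1) unfolding is_root_def by auto
  have n0: "n\<^sub>0 \<in> G"
    by (rule G_step[OF root_fld _ root(2)])
      (use root(3) assms(3) root_le anti fld in \<open>auto simp: underS_def\<close>)
  define Q where "Q = Restr r G"
  have Q_Field: "Field Q = G"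
    using refl unfolding Q_def G_def Field_def by blast
  have Q_po: "Partial_order Q"
    unfolding Q_Field unfolding Q_def partial_order_on_def preorder_on_def refl_on_def antisym_def trans_def
    using refl anti trans by (auto simp: G_def)
  have "\<exists>m\<in>Field Q. \<forall>a\<in>Field Q. (m, a) \<in> Q \<longrightarrow> a = m"
  proof (rule Zorns_po_lemma[OF Q_po])
    fix C assume "C \<in> Chains Q"
    then have C: "C \<subseteq> G" "C \<in> Chains r" unfolding Chains_def Q_def by auto
    have "\<exists>u\<in>G. \<forall>a\<in>C. (a, u) \<in> r"
    proof (cases "C = {}")
      case False
      obtain B where B: "is_branch r B" "C \<subseteq> B" using chain_extends_to_branch[OF C(2)] .
      then obtain k where k: "k \<in> B" "is_leaf r k"
        using der unfolding derivation_def by blast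
      have kF: "k \<in> Field r" using k(2) unfolding is_leaf_def by simp
      (* The nodes of the branch up to the leaf that bound the chain. Ancestors of a node are
         well-ordered, so there is a least one. *)
      define Z where "Z = {z. (z, k) \<in> r \<and> (\<forall>x\<in>C. (x, z) \<in> r)}"
      have "k \<in> Z"
      proof -
        have "(x, k) \<in> r" if "x \<in> C" for x
          using that B k refl[OF kF] unfolding is_branch_def Chains_def is_leaf_def aboveS_def by blast
        then show ?thesis using refl[OF kF] unfolding Z_def by blast
      qed
      obtain m where m: "m \<in> Z" "\<And>z. z \<in> Z \<Longrightarrow> (z, m) \<in> r \<Longrightarrow> z = m"
      proof (cases "Z = {k}")
        case True
        then show thesis using that by blast
      next
        case False
        have wf: "wf (Restr r (underS r k) - Id)"
          using wo[OF kF] unfolding well_order_on_def by blast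
        obtain z where "z \<in> Z - {k}" using False \<open>k \<in> Z\<close> by blast
        then obtain m where mz: "m \<in> Z - {k}"
          "\<And>y. (y, m) \<in> Restr r (underS r k) - Id \<Longrightarrow> y \<notin> Z - {k}"
          using wfE_min[OF wf] by metis
        have "z = m" if z: "z \<in> Z" "(z, m) \<in> r" for z
        proof (rule ccontr)
          assume "z \<noteq> m"
          moreover have "z \<noteq> k" using z(2) mz(1) anti unfolding Z_def by blast
          ultimately show False
            using mz z unfolding Z_def underS_def by blast
        qed
        then show thesis using that mz(1) by blast
      qed
      have mF: "m \<in> Field r" using m(1) fld unfolding Z_def by blast
      (* By minimality of m, the chain is cofinal below m. *)
      have below_C: "\<exists>x\<in>C. (z, x) \<in> r \<and> z \<noteq> x" if z: "z \<in> underS r m" for z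
      proof -
        have zm: "(z, m) \<in> r" "z \<noteq> m" using z unfolding underS_def by auto
        then have "z \<notin> Z" using m(2) by blast
        moreover have "(z, k) \<in> r" using zm(1) m(1) trans unfolding Z_def by blast
        ultimately obtain x where x: "x \<in> C" "(x, z) \<notin> r" unfolding Z_def by blast
        then have "(x, k) \<in> r" using \<open>k \<in> Z\<close> unfolding Z_def by blast
        then show ?thesis using x tot \<open>(z, k) \<in> r\<close> refl fld by blast
      qed
      have "m \<in> G"
      proof (cases "m \<in> C")
        case True
        then show ?thesis using C by blast
      next
        case mC: False
        have under: "n \<in> G" if "n \<in> underS r m" for n
          using below_C[OF that] G_down C(1) by blast
        (* With m outside the chain, the chain has no last element below m, hence m is a limit node. *)
        have "\<not> is_root r m"
        proof
          assume "is_root r m"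
          then have "\<forall>x\<in>C. x = m"
            using m(1) anti fld unfolding Z_def is_root_def by blast
          then show False using False mC by auto
        qed
        moreover have "m \<notin> children r p" for p
        proof
          assume p: "m \<in> children r p"
          then have "p \<in> underS r m" unfolding children_def aboveS_def underS_def by auto
          then obtain x where x: "x \<in> C" "(p, x) \<in> r" "p \<noteq> x" using below_C by blast
          then have "x \<in> aboveS r p \<inter> underS r m"
            using m(1) mC unfolding Z_def aboveS_def underS_def by auto
          then show False using p unfolding children_def by blast
        qed
        ultimately have "l m = Fmlas (\<Union>{\<Gamma>. \<exists>n\<in>underS r m. l n = Fmlas \<Gamma>})"
          using der mF unfolding derivation_def by blast
        moreover have "\<Union>{\<Gamma>. \<exists>n\<in>underS r m. l n = Fmlas \<Gamma>} \<subseteq> T"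
        proof -
          have "\<Gamma> \<subseteq> T" if "n \<in> underS r m" "l n = Fmlas \<Gamma>" for n \<Gamma>
            using under[OF that(1)] that(2) refl unfolding G_def by force
          then show ?thesis by blast
        qed
        ultimately show ?thesis using G_step[OF mF under] by blast
      qed
      then show ?thesis using m(1) unfolding Z_def by blast
    qed (use n0 in blast)
    then obtain u where "u \<in> G" "\<forall>a\<in>C. (a, u) \<in> r" by blast
    then have "\<forall>a\<in>C. (a, u) \<in> Q" using C(1) unfolding Q_def by blast
    then show "\<exists>u\<in>Field Q. \<forall>a\<in>C. (a, u) \<in> Q"
      using \<open>u \<in> G\<close> unfolding Q_Field by blast
  qed
  then obtain n where nQ: "n \<in> Field Q" "\<forall>a\<in>Field Q. (n, a) \<in> Q \<longrightarrow> a = n" by (rule bexE)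
  then have n: "n \<in> G" "\<And>m. m \<in> G \<Longrightarrow> (n, m) \<in> r \<Longrightarrow> m = n"
    unfolding Q_Field by (auto simp: Q_def)
  then have nF: "n \<in> Field r" unfolding G_def by blast
  obtain \<Gamma> where \<Gamma>: "l n = Fmlas \<Gamma>" "\<Gamma> \<subseteq> T"
    using n(1) refl unfolding G_def by blast
  then have "\<not> is_leaf r n" using leaf disj by fastforce
  then have "\<exists>\<Gamma> \<Pi> \<Theta> \<sigma>. l n = Fmlas \<Gamma> \<and> (\<Pi>, \<Theta>) \<in> R \<and> subst \<sigma> ` \<Pi> \<subseteq> \<Gamma> \<and>
      (if \<Theta> = {} then (\<exists>m. children r n = {m} \<and> l m = Star)
       else (\<exists>c. bij_betw c (subst \<sigma> ` \<Theta>) (children r n) \<and>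
              (\<forall>a\<in>subst \<sigma> ` \<Theta>. l (c a) = Fmlas (insert a \<Gamma>))))"
    using der nF unfolding derivation_def by simp
  then obtain \<Delta> \<Pi> \<Theta> \<sigma> where \<Delta>: "l n = Fmlas \<Delta>" and rule: "(\<Pi>, \<Theta>) \<in> R" "subst \<sigma> ` \<Pi> \<subseteq> \<Delta>"
    and ch: "if \<Theta> = {} then (\<exists>m. children r n = {m} \<and> l m = Star)
       else (\<exists>c. bij_betw c (subst \<sigma> ` \<Theta>) (children r n) \<and>
              (\<forall>a\<in>subst \<sigma> ` \<Theta>. l (c a) = Fmlas (insert a \<Delta>)))"
    by (elim exE conjE) (rule that)
  have "\<Delta> = \<Gamma>" using \<Gamma>(1) \<Delta> by simp
  have child_fld: "m \<in> Field r" if "m \<in> children r n" for m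
    using that unfolding children_def aboveS_def Field_def by blast
  have child: "\<exists>m. m \<in> children r n \<and> l m = Fmlas (insert a \<Gamma>)" if "a \<in> subst \<sigma> ` \<Theta>" for a
  proof -
    have "\<Theta> \<noteq> {}" using that by blast
    then obtain c where "bij_betw c (subst \<sigma> ` \<Theta>) (children r n)"
      "\<forall>a\<in>subst \<sigma> ` \<Theta>. l (c a) = Fmlas (insert a \<Gamma>)"
      using ch \<open>\<Delta> = \<Gamma>\<close> by auto
    then show ?thesis using that bij_betwE by blast
  qed
  have within_\<Theta>: "subst \<sigma> ` \<Theta> \<subseteq> \<Lambda>"
  proof
    fix a assume a: "a \<in> subst \<sigma> ` \<Theta>"
    then obtain m where "m \<in> children r n" "l m = Fmlas (insert a \<Gamma>)"
      using child by blast
    then show "a \<in> \<Lambda>" using within child_fld by blast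
  qed
  have "subst \<sigma> ` \<Theta> \<inter> T \<noteq> {}"
    by (rule saturatedD[OF sat rule(1) order_trans[OF rule(2)] within_\<Theta>]) (simp add: \<open>\<Delta> = \<Gamma>\<close> \<Gamma>(2))
  then obtain a where a: "a \<in> subst \<sigma> ` \<Theta>" "a \<in> T" by blast
  then obtain m where m: "m \<in> children r n" "l m = Fmlas (insert a \<Gamma>)"
    using child by blast
  have nm: "(n, m) \<in> r" "n \<noteq> m" using m(1) unfolding children_def aboveS_def by auto
  have "m \<in> G"
  proof (rule G_step[OF child_fld[OF m(1)] _ m(2)])
    fix k assume k: "k \<in> underS r m"
    then have km: "(k, m) \<in> r" unfolding underS_def by simp
    have "(k, n) \<in> r"
    proof (cases "k = n")
      case True
      then show ?thesis using refl[OF nF] by simp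
    next
      case False
      have "k \<notin> aboveS r n" using m(1) k unfolding children_def by blast
      then show ?thesis using tot[OF km nm(1)] False unfolding aboveS_def by auto
    qed
    then show "k \<in> G" using n(1) G_down by blast
  qed (use a \<Gamma> in auto)
  then show False using n(2) nm by blast
qed


section \<open>Derivations of finite height\<close>

text \<open>
  Derivations of finite height, read from the root upwards; the argument \<open>\<Gamma>\<close> is the label of
  the current node.
\<close>

inductive proves :: "rule set \<Rightarrow> form set \<Rightarrow> form set \<Rightarrow> form set \<Rightarrow> bool" for R \<Lambda> \<Psi> where
  hit: "\<Gamma> \<inter> \<Psi> \<noteq> {} \<Longrightarrow> proves R \<Lambda> \<Psi> \<Gamma>"
| rule: "\<lbrakk>(\<Pi>, \<Theta>) \<in> R; subst \<sigma> ` \<Pi> \<subseteq> \<Gamma>; subst \<sigma> ` \<Theta> \<subseteq> \<Lambda>;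
    \<And>a. a \<in> subst \<sigma> ` \<Theta> \<Longrightarrow> proves R \<Lambda> \<Psi> (insert a \<Gamma>)\<rbrakk> \<Longrightarrow> proves R \<Lambda> \<Psi> \<Gamma>"

text \<open>
  A node is represented by the path leading to it: \<^term>\<open>Some a\<close> records that
  \<open>a\<close> was added, and \<^term>\<open>None\<close> a step by a rule with empty conclusion. The path
  determines the label, so a derivation reduces to a prefix-closed set of paths.
\<close>

definition node_label :: "form set \<Rightarrow> form option list \<Rightarrow> label" where
  "node_label \<Gamma> xs = (if None \<in> set xs then Star else Fmlas (\<Gamma> \<union> {a. Some a \<in> set xs}))"

definition successors :: "'b list set \<Rightarrow> 'b list \<Rightarrow> 'b set" where
  "successors N xs = {s. xs @ [s] \<in> N}"

definition path_ok ::
  "rule set \<Rightarrow> form set \<Rightarrow> form set \<Rightarrow> form set \<Rightarrow> form option list set \<Rightarrow> form option list \<Rightarrow> bool" where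
  "path_ok R \<Lambda> \<Psi> \<Gamma> N xs \<longleftrightarrow>
    (\<forall>\<Delta>. node_label \<Gamma> xs = Fmlas \<Delta> \<longrightarrow> \<Delta> \<subseteq> \<Lambda>) \<and>
    (successors N xs = {} \<and>
      (node_label \<Gamma> xs = Star \<or> (\<exists>\<Delta>. node_label \<Gamma> xs = Fmlas \<Delta> \<and> \<Delta> \<inter> \<Psi> \<noteq> {})) \<or>
    (\<exists>\<Delta> \<Pi> \<Theta> \<sigma>. node_label \<Gamma> xs = Fmlas \<Delta> \<and> (\<Pi>, \<Theta>) \<in> R \<and> subst \<sigma> ` \<Pi> \<subseteq> \<Delta> \<and>
      successors N xs = (if \<Theta> = {} then {None} else Some ` subst \<sigma> ` \<Theta>)))"

definition path_tree ::
  "rule set \<Rightarrow> form set \<Rightarrow> form set \<Rightarrow> form set \<Rightarrow> form option list set \<Rightarrow> bool" where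
  "path_tree R \<Lambda> \<Psi> \<Gamma> N \<longleftrightarrow> finite N \<and> [] \<in> N \<and> (\<forall>xs ys. xs @ ys \<in> N \<longrightarrow> xs \<in> N) \<and>
    (\<forall>xs\<in>N. path_ok R \<Lambda> \<Psi> \<Gamma> N xs)"

lemma node_label_Cons: "node_label \<Gamma> (Some a # xs) = node_label (insert a \<Gamma>) xs"
  unfolding node_label_def by auto

text \<open>
  The paths of the derivation are those of the derivations for the children, prefixed with the formula
  that was added; moving this formula from the path into the root label leaves all node labels
  unchanged (\<open>node_label_Cons\<close>).
\<close>

lemma proves_path_tree:
  assumes fin: "\<And>\<Pi> \<Theta>. (\<Pi>, \<Theta>) \<in> R \<Longrightarrow> finite \<Theta>"
  shows "proves R \<Lambda> \<Psi> \<Gamma> \<Longrightarrow> \<Gamma> \<subseteq> \<Lambda> \<Longrightarrow> \<exists>N. path_tree R \<Lambda> \<Psi> \<Gamma> N"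
proof (induction rule: proves.induct)
  case (hit \<Gamma>)
  have "path_tree R \<Lambda> \<Psi> \<Gamma> {[]}"
    using hit unfolding path_tree_def path_ok_def node_label_def successors_def by auto
  then show ?case ..
next
  case (rule \<Pi> \<Theta> \<sigma> \<Gamma>)
  show ?case
  proof (cases "\<Theta> = {}")
    case True
    have "path_ok R \<Lambda> \<Psi> \<Gamma> {[], [None]} []"
    proof -
      have "successors {[], [None]} [] = {None :: form option}" unfolding successors_def by auto
      then show ?thesis
        unfolding path_ok_def using rule.hyps(1,2) rule.prems True by (auto simp: node_label_def)
    qed
    moreover have "path_ok R \<Lambda> \<Psi> \<Gamma> {[], [None]} [None]"
      unfolding path_ok_def node_label_def successors_def by simp
    ultimately have "path_tree R \<Lambda> \<Psi> \<Gamma> {[], [None]}"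
      unfolding path_tree_def by (auto simp: append_eq_Cons_conv)
    then show ?thesis ..
  next
    case False
    have "\<forall>a\<in>subst \<sigma> ` \<Theta>. \<exists>N. path_tree R \<Lambda> \<Psi> (insert a \<Gamma>) N"
      using rule by blast
    then obtain f where f: "\<And>a. a \<in> subst \<sigma> ` \<Theta> \<Longrightarrow> path_tree R \<Lambda> \<Psi> (insert a \<Gamma>) (f a)"
      by metis
    define N where "N = insert [] (\<Union>a\<in>subst \<sigma> ` \<Theta>. (#) (Some a) ` f a)"
    have Nil_f: "[] \<in> f a" if "a \<in> subst \<sigma> ` \<Theta>" for a
      using f[OF that] unfolding path_tree_def by blast
    have Cons_N: "x # xs \<in> N \<longleftrightarrow> (\<exists>a\<in>subst \<sigma> ` \<Theta>. x = Some a \<and> xs \<in> f a)" for x xs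
      unfolding N_def by auto
    have succ_Nil: "successors N [] = Some ` subst \<sigma> ` \<Theta>"
      unfolding successors_def using Cons_N Nil_f by auto
    have succ_Cons: "successors N (Some a # xs) = successors (f a) xs" if "a \<in> subst \<sigma> ` \<Theta>" for a xs
      unfolding successors_def using Cons_N that by auto
    have "path_ok R \<Lambda> \<Psi> \<Gamma> N xs" if "xs \<in> N" for xs
    proof (cases xs)
      case Nil
      have "successors N [] = (if \<Theta> = {} then {None} else Some ` subst \<sigma> ` \<Theta>)"
        using succ_Nil False by simp
      moreover have "node_label \<Gamma> [] = Fmlas \<Gamma>" by (simp add: node_label_def)
      ultimately show ?thesis
        unfolding path_ok_def Nil using rule.hyps(1,2) rule.prems
        by (intro conjI disjI2 exI[of _ \<Gamma>] exI[of _ \<Pi>] exI[of _ \<Theta>] exI[of _ \<sigma>]) simp_all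
    next
      case (Cons x ys)
      then obtain a where a: "a \<in> subst \<sigma> ` \<Theta>" "x = Some a" "ys \<in> f a" using \<open>xs \<in> N\<close> Cons_N[of x ys] by auto
      then have "path_ok R \<Lambda> \<Psi> (insert a \<Gamma>) (f a) ys" using f[OF a(1)] unfolding path_tree_def by simp
      then show ?thesis
        unfolding path_ok_def Cons a(2) node_label_Cons succ_Cons[OF a(1)] .
    qed
    moreover have "finite N"
      unfolding N_def using fin[OF rule.hyps(1)] f unfolding path_tree_def by simp
    moreover have "xs \<in> N" if "xs @ ys \<in> N" for xs ys
    proof (cases xs)
      case Nil
      then show ?thesis unfolding N_def by simp
    next
      case (Cons x zs)
      then obtain a where a: "a \<in> subst \<sigma> ` \<Theta>" "x = Some a" "zs @ ys \<in> f a"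
        using \<open>xs @ ys \<in> N\<close> Cons_N[of x "zs @ ys"] by auto
      then have "zs \<in> f a" using f[OF a(1)] unfolding path_tree_def by blast
      then show ?thesis using a Cons Cons_N by blast
    qed
    moreover have "[] \<in> N" unfolding N_def by simp
    ultimately have "path_tree R \<Lambda> \<Psi> \<Gamma> N" unfolding path_tree_def by simp
    then show ?thesis ..
  qed
qed

instance form :: countable
  by countable_datatype

text \<open>
  The prefix order on paths is a rooted tree whose children extend their parent by a single entry.
  There are countably many paths, so the nodes can be renamed injectively into any infinite type.
  Finiteness of \<open>N\<close> guarantees that every branch has a longest path, which is a leaf, and
  every node other than the root is a child, so that the condition on limit nodes is vacuous.
\<close>

lemma path_tree_derives_within:
  assumes N: "path_tree R \<Lambda> \<Psi> \<Gamma> N" and inf: "infinite (UNIV :: 'n set)"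
  shows "derives_within TYPE('n) R \<Lambda> \<Gamma> \<Psi>"
proof -
  obtain f :: "nat \<Rightarrow> 'n" where f: "inj f" using infinite_countable_subset[OF inf] by blast
  define e :: "form option list \<Rightarrow> 'n" where "e = f \<circ> to_nat"
  have "inj e" unfolding e_def using f by (intro inj_compose) simp_all
  then have e_eq: "e xs = e ys \<longleftrightarrow> xs = ys" for xs ys by (simp add: inj_eq)
  define r where "r = {(e xs, e ys) | xs ys. xs \<in> N \<and> ys \<in> N \<and> prefix xs ys}"
  define l where "l = (\<lambda>n. node_label \<Gamma> (inv e n))"
  have l_e: "l (e xs) = node_label \<Gamma> xs" for xs
    unfolding l_def using \<open>inj e\<close> by simp
  have finN: "finite N" and Nil_N: "[] \<in> N" and closedN: "\<And>xs ys. xs @ ys \<in> N \<Longrightarrow> xs \<in> N"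
    and okN: "\<And>xs. xs \<in> N \<Longrightarrow> path_ok R \<Lambda> \<Psi> \<Gamma> N xs"
    using N unfolding path_tree_def by blast+
  have r_iff: "(e xs, e ys) \<in> r \<longleftrightarrow> xs \<in> N \<and> ys \<in> N \<and> prefix xs ys" for xs ys
    unfolding r_def by (auto simp: e_eq)
  have Field_r: "Field r = e ` N"
    unfolding Field_def r_def by auto
  have above: "aboveS r (e xs) = e ` {ys \<in> N. strict_prefix xs ys}" if "xs \<in> N" for xs
    using that unfolding aboveS_def by (auto simp: r_def e_eq strict_prefix_def) 
  have under: "underS r (e ys) = e ` {xs \<in> N. strict_prefix xs ys}" if "ys \<in> N" for ys
    using that unfolding underS_def by (auto simp: r_def e_eq strict_prefix_def)
  have children: "children r (e xs) = e ` (\<lambda>s. xs @ [s]) ` successors N xs" if xs: "xs \<in> N" for xs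
  proof (intro set_eqI iffI)
    fix m assume m: "m \<in> children r (e xs)"
    then obtain ys where ys: "m = e ys" "ys \<in> N" "strict_prefix xs ys"
      unfolding children_def above[OF xs] by blast
    then obtain s zs where szs: "ys = xs @ s # zs" by (metis strict_prefixE')
    then have s: "xs @ [s] \<in> N" using ys(2) closedN[of "xs @ [s]" zs] by simp
    have "zs = []"
    proof (rule ccontr)
      assume "zs \<noteq> []"
      then have "strict_prefix (xs @ [s]) ys" unfolding szs by (simp add: strict_prefix_def)
      then have "e (xs @ [s]) \<in> aboveS r (e xs) \<inter> underS r m"
        using s by (auto simp: above[OF xs] ys(1) under[OF ys(2)] strict_prefix_def)
      then show False using m unfolding children_def by blast
    qed
    then show "m \<in> e ` (\<lambda>s. xs @ [s]) ` successors N xs"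
      using s ys(1) szs unfolding successors_def by blast
  next
    fix m assume "m \<in> e ` (\<lambda>s. xs @ [s]) ` successors N xs"
    then obtain s where s: "m = e (xs @ [s])" "xs @ [s] \<in> N" unfolding successors_def by blast
    have between: "\<not> (strict_prefix xs zs \<and> strict_prefix zs (xs @ [s]))" for zs
      by (auto simp: strict_prefix_def)
    have "aboveS r (e xs) \<inter> underS r m = {}"
    proof (rule ccontr)
      assume "aboveS r (e xs) \<inter> underS r m \<noteq> {}"
      then obtain n where n: "n \<in> aboveS r (e xs)" "n \<in> underS r m" by blast
      obtain zs where zs: "n = e zs" "strict_prefix xs zs" using n(1) unfolding above[OF xs] by blast
      have "strict_prefix zs (xs @ [s])"
        using n(2) unfolding s(1) zs(1) under[OF s(2)] by (auto simp: e_eq)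
      then show False using between zs(2) by blast
    qed
    moreover have "m \<in> aboveS r (e xs)"
      unfolding above[OF xs] s(1) using s(2) by (simp add: strict_prefix_def)
    ultimately show "m \<in> children r (e xs)" unfolding children_def by blast
  qed
  have root: "is_root r (e xs) \<longleftrightarrow> xs = []" if "xs \<in> N" for xs
    using that Nil_N unfolding is_root_def Field_r by (auto simp: r_iff)
  have leaf: "is_leaf r (e xs) \<longleftrightarrow> successors N xs = {}" if xs: "xs \<in> N" for xs
  proof
    assume leaf: "is_leaf r (e xs)"
    have "xs @ [s] \<notin> N" for s
    proof
      assume "xs @ [s] \<in> N"
      then have "e (xs @ [s]) \<in> aboveS r (e xs)"
        unfolding above[OF xs] by (simp add: strict_prefix_def)
      then show False using leaf unfolding is_leaf_def by blast
    qed
    then show "successors N xs = {}" unfolding successors_def by simp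
  next
    assume empty: "successors N xs = {}"
    have "\<not> strict_prefix xs ys" if "ys \<in> N" for ys
    proof
      assume "strict_prefix xs ys"
      then obtain s zs where "ys = xs @ s # zs" by (metis strict_prefixE')
      then have "xs @ [s] \<in> N" using that closedN[of "xs @ [s]" zs] by simp
      then show False using empty unfolding successors_def by blast
    qed
    then have "aboveS r (e xs) = {}" unfolding above[OF xs] by blast
    then show "is_leaf r (e xs)"
      using xs unfolding is_leaf_def Field_r by blast
  qed
  have "rooted_tree r"
    unfolding rooted_tree_def
  proof (intro conjI ballI)
    show "partial_order_on (Field r) r"
      unfolding partial_order_on_def preorder_on_def
    proof (intro conjI)
      show "refl_on (Field r) r" unfolding refl_on_def Field_r by (auto simp: r_iff)
      show "trans r"
        by (rule transI) (auto simp: r_def e_eq intro: prefix_order.trans)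
      show "antisym r"
        by (rule antisymI) (auto simp: r_def e_eq intro: prefix_order.antisym)
      show "r \<subseteq> Field r \<times> Field r" by (auto simp: Field_def)
    qed
    show "\<exists>n. is_root r n" using root Nil_N by blast
    fix n assume "n \<in> Field r"
    then obtain ys where ys: "n = e ys" "ys \<in> N" unfolding Field_r by blast
    let ?U = "underS r n"
    have U: "?U = e ` {xs \<in> N. strict_prefix xs ys}" using under ys by blast
    have "linear_order_on ?U (Restr r ?U)"
      unfolding linear_order_on_def partial_order_on_def preorder_on_def
    proof (intro conjI)
      show "refl_on ?U (Restr r ?U)" unfolding refl_on_def U by (auto simp: r_iff)
      show "trans (Restr r ?U)"
        by (rule transI) (auto simp: r_def e_eq intro: prefix_order.trans)
      show "antisym (Restr r ?U)"
        by (rule antisymI) (auto simp: r_def e_eq intro: prefix_order.antisym)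
      show "Restr r ?U \<subseteq> ?U \<times> ?U" by blast
      show "total_on ?U (Restr r ?U)"
        unfolding total_on_def U by (auto simp: r_iff strict_prefix_def dest: prefix_same_cases)
    qed
    moreover have "wf (Restr r ?U - Id)"
    proof (rule wf_subset[OF wf_measure[of "\<lambda>n. length (inv e n)"]], rule subrelI)
      fix m n assume "(m, n) \<in> Restr r ?U - Id"
      then obtain xs zs where "m = e xs" "n = e zs" "strict_prefix xs zs"
        unfolding r_def strict_prefix_def by auto
      then show "(m, n) \<in> measure (\<lambda>n. length (inv e n))"
        using \<open>inj e\<close> by (simp add: prefix_length_less)
    qed
    ultimately show "well_order_on ?U (Restr r ?U)" unfolding well_order_on_def by blast
  qed
  moreover have "\<exists>n\<in>B. is_leaf r n" if B: "is_branch r B" for B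
  proof -
    have BF: "B \<subseteq> Field r" using B unfolding is_branch_def Chains_def Field_def by blast
    have Bc: "\<And>x y. x \<in> B \<Longrightarrow> y \<in> B \<Longrightarrow> (x, y) \<in> r \<or> (y, x) \<in> r"
      using B unfolding is_branch_def Chains_def by blast
    have "finite B" using BF finN finite_subset unfolding Field_r by blast
    moreover have "B \<noteq> {}"
    proof
      assume "B = {}"
      moreover have "{e []} \<in> Chains r" using Nil_N by (simp add: Chains_def r_iff)
      ultimately show False using B unfolding is_branch_def by blast
    qed
    ultimately have "Max ((\<lambda>n. length (inv e n)) ` B) \<in> (\<lambda>n. length (inv e n)) ` B"
      by (intro Max_in) auto
    then obtain n where "n \<in> B" "length (inv e n) = Max ((\<lambda>n. length (inv e n)) ` B)" by auto
    then have n: "n \<in> B" "\<And>m. m \<in> B \<Longrightarrow> length (inv e m) \<le> length (inv e n)"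
      using \<open>finite B\<close> by simp_all
    obtain xs where xs: "n = e xs" "xs \<in> N" using n(1) BF unfolding Field_r by blast
    have "successors N xs = {}"
    proof (rule ccontr)
      assume "successors N xs \<noteq> {}"
      then obtain s where s: "xs @ [s] \<in> N" unfolding successors_def by blast
      let ?m = "e (xs @ [s])"
      have le: "(m, n) \<in> r" if m: "m \<in> B" for m
      proof -
        obtain ys where ys: "m = e ys" "ys \<in> N" using m BF unfolding Field_r by blast
        have "length ys \<le> length xs" using n(2)[OF m] \<open>inj e\<close> unfolding ys xs by simp
        then show ?thesis
          using Bc[OF m n(1)] unfolding ys xs r_iff
          by (auto simp: prefix_def)
      qed
      have "(m, ?m) \<in> r" if m: "m \<in> B" for m
      proof -
        obtain ys where ys: "m = e ys" "ys \<in> N" using m BF unfolding Field_r by blast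
        then show ?thesis using le[OF m] s unfolding ys xs r_iff by (simp add: prefix_prefix)
      qed
      then have "insert ?m B \<in> Chains r"
        using Bc s unfolding Chains_def by (auto simp: r_iff)
      then have "insert ?m B = B" using B unfolding is_branch_def by (meson subset_insertI)
      then have "?m \<in> B" by blast
      then show False using n(2)[of ?m] \<open>inj e\<close> unfolding xs by simp
    qed
    then show ?thesis using n(1) leaf xs by blast
  qed
  moreover have "\<exists>\<Delta> \<Pi> \<Theta> \<sigma>. l n = Fmlas \<Delta> \<and> (\<Pi>, \<Theta>) \<in> R \<and> subst \<sigma> ` \<Pi> \<subseteq> \<Delta> \<and>
      (if \<Theta> = {} then (\<exists>m. children r n = {m} \<and> l m = Star)
       else (\<exists>c. bij_betw c (subst \<sigma> ` \<Theta>) (children r n) \<and>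
              (\<forall>a\<in>subst \<sigma> ` \<Theta>. l (c a) = Fmlas (insert a \<Delta>))))"
    if n: "n \<in> Field r" "\<not> is_leaf r n" for n
  proof -
    obtain xs where xs: "n = e xs" "xs \<in> N" using n(1) unfolding Field_r by blast
    then have "successors N xs \<noteq> {}" using n(2) leaf by blast
    then obtain \<Delta> \<Pi> \<Theta> \<sigma> where \<Delta>: "node_label \<Gamma> xs = Fmlas \<Delta>" "(\<Pi>, \<Theta>) \<in> R" "subst \<sigma> ` \<Pi> \<subseteq> \<Delta>"
      and succ: "successors N xs = (if \<Theta> = {} then {None} else Some ` subst \<sigma> ` \<Theta>)"
      using okN[OF xs(2)] unfolding path_ok_def by (elim conjE disjE exE) (((rule that; assumption) | (simp; fail))+)
    have notin: "None \<notin> set xs" using \<Delta>(1) unfolding node_label_def by (auto split: if_splits)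
    have "if \<Theta> = {} then (\<exists>m. children r n = {m} \<and> l m = Star)
       else (\<exists>c. bij_betw c (subst \<sigma> ` \<Theta>) (children r n) \<and>
              (\<forall>a\<in>subst \<sigma> ` \<Theta>. l (c a) = Fmlas (insert a \<Delta>)))"
    proof (cases "\<Theta> = {}")
      case True
      have "children r n = {e (xs @ [None])}"
        using children[OF xs(2)] succ True xs(1) by simp
      moreover have "l (e (xs @ [None])) = Star" by (simp add: l_e node_label_def)
      ultimately show ?thesis using True by simp
    next
      case False
      let ?c = "\<lambda>a. e (xs @ [Some a])"
      have "bij_betw ?c (subst \<sigma> ` \<Theta>) (children r n)"
        unfolding bij_betw_def
      proof
        show "inj_on ?c (subst \<sigma> ` \<Theta>)" by (rule inj_onI) (simp add: e_eq)
        show "?c ` subst \<sigma> ` \<Theta> = children r n"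
          unfolding xs(1) children[OF xs(2)] succ using False by (simp add: image_image)
      qed
      moreover have "l (?c a) = Fmlas (insert a \<Delta>)" for a
        using \<Delta>(1) notin by (auto simp: l_e node_label_def)
      ultimately have "\<exists>c. bij_betw c (subst \<sigma> ` \<Theta>) (children r n) \<and>
              (\<forall>a\<in>subst \<sigma> ` \<Theta>. l (c a) = Fmlas (insert a \<Delta>))" by blast
      then show ?thesis using False by simp
    qed
    then show ?thesis
      using \<Delta> unfolding xs(1) l_e by (intro exI conjI)
  qed
  moreover have "\<exists>m\<in>Field r. n \<in> children r m" if n: "n \<in> Field r" "\<not> is_root r n" for n
  proof -
    obtain xs where xs: "n = e xs" "xs \<in> N" using n(1) unfolding Field_r by blast
    then have "xs \<noteq> []" using n(2) root by blast
    then obtain ys s where s: "xs = ys @ [s]" by (metis rev_exhaust)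
    then have "ys \<in> N" using closedN xs(2) by blast
    then show ?thesis using children[of ys] xs s unfolding Field_r successors_def by blast
  qed
  ultimately have "derivation R r l"
    unfolding derivation_def by (intro conjI ballI allI impI) (simp_all, blast)
  moreover have "is_root r (e [])" using root Nil_N by blast
  moreover have "l (e []) = Fmlas \<Gamma>" by (simp add: l_e node_label_def)
  moreover have "l n = Star \<or> (\<exists>\<Delta>. l n = Fmlas \<Delta> \<and> \<Delta> \<inter> \<Psi> \<noteq> {})" if n: "is_leaf r n" for n
  proof -
    obtain xs where xs: "n = e xs" "xs \<in> N" using n unfolding is_leaf_def Field_r by blast
    then have "successors N xs = {}" using n leaf by blast
    then show ?thesis
      using okN[OF xs(2)] unfolding path_ok_def xs(1) l_e by (auto split: if_splits)
  qed
  moreover have "\<Delta> \<subseteq> \<Lambda>" if n: "n \<in> Field r" "l n = Fmlas \<Delta>" for n \<Delta>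
  proof -
    obtain xs where xs: "n = e xs" "xs \<in> N" using n(1) unfolding Field_r by blast
    show ?thesis using okN[OF xs(2)] n(2) unfolding path_ok_def xs(1) l_e by simp
  qed
  ultimately show ?thesis
    unfolding derives_within_def
    by (intro exI[of _ r] exI[of _ l] exI[of _ "e []"] exI[of _ \<Gamma>] conjI allI ballI impI) simp_all
qed


section \<open>The six-element algebra\<close>

text \<open>
  The bits of an element say whether it, its negation and its image under \<open>\<circ>\<close> belong to
  a fixed prime filter; the constraint leaves six of the eight triples. Among them, the top element is
  \<open>(True, False, True)\<close>, and the two fixed points of negation are
  \<open>(True, True, False)\<close> (glut) and \<open>(False, False, False)\<close> (gap). The third bit of
  a meet is set if both arguments are perfect, or if one of them is perfect and false, that is, the
  bottom element.
\<close>

definition pp6 :: "(bool \<times> bool \<times> bool) alg" where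
  "pp6 = \<lparr>carrier = {(d, e, c). c \<longrightarrow> d \<noteq> e},
    meet = \<lambda>(d, e, c) (d', e', c'). (d \<and> d', e \<or> e', c \<and> c' \<or> c \<and> \<not> d \<or> c' \<and> \<not> d'),
    join = \<lambda>(d, e, c) (d', e', c'). (d \<or> d', e \<and> e', c \<and> c' \<or> c \<and> d \<or> c' \<and> d'),
    neg = \<lambda>(d, e, c). (e, d, c),
    circ = \<lambda>(d, e, c). (c, \<not> c, True),
    top_el = (True, False, True),
    bot_el = (False, True, True)\<rparr>"

lemma pp_algebra_pp6: "pp_algebra pp6"
  by unfold_locales (auto simp: pp6_def)

text \<open>
  Consequence only quantifies over algebras whose carrier lies in the given infinite type, so the
  six-element algebra is copied there along an injection.
\<close>

definition transport :: "('b \<Rightarrow> 'a) \<Rightarrow> 'b alg \<Rightarrow> 'a alg" where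
  "transport g A = \<lparr>carrier = g ` carrier A,
    meet = \<lambda>x y. g (meet A (inv g x) (inv g y)),
    join = \<lambda>x y. g (join A (inv g x) (inv g y)),
    neg = \<lambda>x. g (neg A (inv g x)),
    circ = \<lambda>x. g (circ A (inv g x)),
    top_el = g (top_el A),
    bot_el = g (bot_el A)\<rparr>"

lemma pp_algebra_transport:
  assumes "pp_algebra A" "inj g"
  shows "pp_algebra (transport g A)"
proof -
  interpret pp_algebra A by fact
  note closed = meet_closed join_closed neg_closed circ_closed top_closed bot_closed
  note laws = meet_join_absorb join_meet_absorb meet_join_distrib meet_top join_bot
    neg_neg neg_meet circ_circ circ_top circ_meet meet_assoc join_assoc
  show ?thesis
  proof unfold_locales
    fix x y assume "x \<in> carrier (transport g A)" "y \<in> carrier (transport g A)"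
    then show "meet (transport g A) x y = meet (transport g A) y x"
      "join (transport g A) x y = join (transport g A) y x"
      using \<open>inj g\<close> by (auto simp: transport_def meet_comm join_comm)
  next
    fix x assume "x \<in> carrier (transport g A)"
    then show "circ (transport g A) x = circ (transport g A) (neg (transport g A) x)"
      using \<open>inj g\<close> by (auto simp: transport_def circ_neg[symmetric])
  next
    fix x assume "x \<in> carrier (transport g A)"
    then show "meet (transport g A) (meet (transport g A) x (neg (transport g A) x)) (circ (transport g A) x)
        = bot_el (transport g A)"
      using \<open>inj g\<close> by (auto simp: transport_def meet_neg_circ)
  qed (use \<open>inj g\<close> in \<open>auto simp: transport_def closed laws\<close>)
qed

lemma eval_transport:
  "inj g \<Longrightarrow> eval (transport g A) (\<lambda>x. g (v x)) a = g (eval A v a)"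
  by (induction a) (simp_all add: transport_def)

lemma pp_valid_pp6:
  assumes "pp_valid TYPE('a) a b" "infinite (UNIV :: 'a set)" "\<And>x. v x \<in> carrier pp6"
  shows "eval pp6 v a = eval pp6 v b"
proof -
  obtain f :: "nat \<Rightarrow> 'a" where "inj f" using infinite_countable_subset[OF assms(2)] by blast
  then obtain g :: "bool \<times> bool \<times> bool \<Rightarrow> 'a" where g: "inj g"
    using inj_compose[OF _ inj_to_nat] by blast
  have "eval (transport g pp6) (\<lambda>x. g (v x)) a = eval (transport g pp6) (\<lambda>x. g (v x)) b"
    using assms(1) pp_algebra_transport[OF pp_algebra_pp6 g] assms(3)
    unfolding pp_valid_def by (auto simp: transport_def)
  then show ?thesis using g by (simp add: eval_transport inj_eq)
qed


section \<open>Completeness within the generalized subformulas\<close>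

text \<open>
  If \<open>T\<close> is maximal among the unprovable subsets of \<open>\<Lambda>\<close>, a rule instance with premises
  in \<open>T\<close> and all conclusions in \<open>\<Lambda>\<close> but outside \<open>T\<close> would lead to a proof, since
  each of its branches starts from a larger set.
\<close>

lemma saturated_extension:
  assumes "finite \<Lambda>" "\<Gamma> \<subseteq> \<Lambda>" "\<not> proves R \<Lambda> \<Psi> \<Gamma>"
  obtains T where "\<Gamma> \<subseteq> T" "T \<inter> \<Psi> = {}" "saturated R \<Lambda> T"
proof -
  let ?F = "{T. T \<subseteq> \<Lambda> \<and> \<not> proves R \<Lambda> \<Psi> T}"
  have "finite ?F" using assms(1) by simp
  then obtain T where T: "T \<in> ?F" "\<Gamma> \<subseteq> T" "\<forall>X\<in>?F. T \<subseteq> X \<longrightarrow> T = X"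
    using finite_has_maximal2[of ?F \<Gamma>] assms(2,3) by auto
  have "saturated R \<Lambda> T"
    unfolding saturated_def
  proof (clarify)
    fix \<Pi> \<Theta> \<sigma>
    assume rule: "(\<Pi>, \<Theta>) \<in> R" "subst \<sigma> ` \<Pi> \<subseteq> T" "subst \<sigma> ` \<Theta> \<subseteq> \<Lambda>" and disj: "subst \<sigma> ` \<Theta> \<inter> T = {}"
    have "proves R \<Lambda> \<Psi> (insert a T)" if a: "a \<in> subst \<sigma> ` \<Theta>" for a
    proof (rule ccontr)
      assume "\<not> proves R \<Lambda> \<Psi> (insert a T)"
      then have "insert a T \<in> ?F" using T(1) a rule(3) by blast
      then have "T = insert a T" using T(3) by (meson subset_insertI)
      then show False using a disj by blast
    qed
    then have "proves R \<Lambda> \<Psi> T" using proves.rule[OF rule] by simp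
    then show False using T(1) by simp
  qed
  moreover have "T \<inter> \<Psi> = {}" using T(1) proves.hit by fastforce
  ultimately show thesis using that T(2) by simp
qed

lemma subformulas_refl: "a \<in> subformulas a"
  by (cases a) simp_all

lemma subformulas_trans: "b \<in> subformulas a \<Longrightarrow> subformulas b \<subseteq> subformulas a"
  by (induction a) auto

lemma sub_closed: "b \<in> sub \<Phi> \<Longrightarrow> subformulas b \<subseteq> sub \<Phi>"
  unfolding sub_def using subformulas_trans by blast

lemma sub_components:
  "Neg a \<in> sub \<Phi> \<Longrightarrow> a \<in> sub \<Phi>" "Circ a \<in> sub \<Phi> \<Longrightarrow> a \<in> sub \<Phi>"
  "And a b \<in> sub \<Phi> \<Longrightarrow> a \<in> sub \<Phi> \<and> b \<in> sub \<Phi>" "Or a b \<in> sub \<Phi> \<Longrightarrow> a \<in> sub \<Phi> \<and> b \<in> sub \<Phi>"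
  using sub_closed[of _ \<Phi>] subformulas_refl by fastforce+

lemma finite_sub: "finite \<Phi> \<Longrightarrow> finite (sub \<Phi>)"
proof -
  have "finite (subformulas a)" for a by (induction a) simp_all
  then show "finite \<Phi> \<Longrightarrow> finite (sub \<Phi>)" unfolding sub_def by simp
qed

lemma sub_mono: "\<Phi> \<subseteq> \<Psi> \<Longrightarrow> sub \<Phi> \<subseteq> sub \<Psi>"
  unfolding sub_def by blast

lemma generalized_subformulas_mono:
  "\<Phi> \<subseteq> \<Psi> \<Longrightarrow> generalized_subformulas \<Xi> \<Phi> \<subseteq> generalized_subformulas \<Xi> \<Psi>"
  using sub_mono[of \<Phi> \<Psi>] unfolding generalized_subformulas_def by blast

lemma generalized_subformulas_S_circ:
  "generalized_subformulas S_circ \<Phi> = sub \<Phi> \<union> Neg ` sub \<Phi> \<union> Circ ` sub \<Phi> \<union> (\<lambda>a. Neg (Circ a)) ` sub \<Phi>"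
  (is "_ = ?R")
proof
  show "generalized_subformulas S_circ \<Phi> \<subseteq> ?R"
    unfolding generalized_subformulas_def S_circ_def S_def Let_def by auto
  have "subst (\<lambda>_. b) a \<in> generalized_subformulas S_circ \<Phi>" if "b \<in> sub \<Phi>" "a \<in> S_circ" for a b
    using that unfolding generalized_subformulas_def by blast
  moreover have "Neg (Var 0) \<in> S_circ" "Circ (Var 0) \<in> S_circ" "Neg (Circ (Var 0)) \<in> S_circ"
    by (simp_all add: S_circ_def Let_def)
  ultimately have "Neg b \<in> generalized_subformulas S_circ \<Phi>" "Circ b \<in> generalized_subformulas S_circ \<Phi>"
    "Neg (Circ b) \<in> generalized_subformulas S_circ \<Phi>" if "b \<in> sub \<Phi>" for b
    using that by force+
  moreover have "sub \<Phi> \<subseteq> generalized_subformulas S_circ \<Phi>"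
    unfolding generalized_subformulas_def by blast
  ultimately show "?R \<subseteq> generalized_subformulas S_circ \<Phi>" by blast
qed

text \<open>
  Rules mention only the variables 0 and 1, so an instance is given by a pair of formulas.
\<close>

lemma saturated_instances:
  assumes "saturated R \<Lambda> T"
  shows "\<forall>(\<Pi>, \<Theta>)\<in>R. subst (\<lambda>x. if x = 0 then a else b) ` \<Pi> \<subseteq> T \<longrightarrow>
    subst (\<lambda>x. if x = 0 then a else b) ` \<Theta> \<subseteq> \<Lambda> \<longrightarrow> (\<exists>c\<in>\<Theta>. subst (\<lambda>x. if x = 0 then a else b) c \<in> T)"
proof clarify
  fix \<Pi> \<Theta>
  let ?\<sigma> = "\<lambda>x. if x = 0 then a else b"
  assume "(\<Pi>, \<Theta>) \<in> R" "subst ?\<sigma> ` \<Pi> \<subseteq> T" "subst ?\<sigma> ` \<Theta> \<subseteq> \<Lambda>"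
  then have "subst ?\<sigma> ` \<Theta> \<inter> T \<noteq> {}" by (rule saturatedD[OF assms])
  then show "\<exists>c\<in>\<Theta>. subst ?\<sigma> c \<in> T" by blast
qed

context
  fixes \<Lambda> T
  assumes sat: "saturated (R_B \<union> R_circ) \<Lambda> T"
begin

text \<open>
  Every rule instance has now become a propositional clause. The following lemmas combine these into
  equivalences that mirror the operations of \<^const>\<open>pp6\<close>; their hypotheses list the
  conclusions that have to be available in \<open>\<Lambda>\<close>.
\<close>

lemma saturated_Top:
  "{Top, Circ Top} \<subseteq> \<Lambda> \<Longrightarrow> Top \<in> T \<and> Neg Top \<notin> T \<and> Circ Top \<in> T"
  using saturated_instances[OF sat, of Top Top]
  unfolding R_B_def R_circ_def Let_def by (simp (no_asm_use), argo)

lemma saturated_Bot: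
  "{Neg Bot, Circ Bot} \<subseteq> \<Lambda> \<Longrightarrow> Bot \<notin> T \<and> Neg Bot \<in> T \<and> Circ Bot \<in> T"
  using saturated_instances[OF sat, of Top Top]
  unfolding R_B_def R_circ_def Let_def by (simp (no_asm_use), argo)

lemma saturated_classical:
  "{a, Neg a} \<subseteq> \<Lambda> \<Longrightarrow> Circ a \<in> T \<Longrightarrow> a \<in> T \<longleftrightarrow> Neg a \<notin> T"
  using saturated_instances[OF sat, of a a]
  unfolding R_B_def R_circ_def Let_def by (simp (no_asm_use), argo)

lemma saturated_Neg:
  assumes "{a, Neg (Neg a), Circ a, Circ (Neg a)} \<subseteq> \<Lambda>"
  shows "Neg (Neg a) \<in> T \<longleftrightarrow> a \<in> T" "Circ (Neg a) \<in> T \<longleftrightarrow> Circ a \<in> T"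
  using assms saturated_instances[OF sat, of a a]
  unfolding R_B_def R_circ_def Let_def by (simp (no_asm_use), argo)+

text \<open>
  The axiom \<open>\<circ>\<circ>p\<close> makes \<open>\<circ>a\<close> classical. To conclude that
  \<open>\<circ>a\<close> or \<open>\<sim>\<circ>a\<close> holds, the formula \<open>\<sim>\<circ>a\<close> must belong to
  \<open>\<Lambda>\<close>.
\<close>

lemma saturated_Circ:
  assumes "{Circ a, Neg (Circ a), Circ (Circ a)} \<subseteq> \<Lambda>"
  shows "Neg (Circ a) \<in> T \<longleftrightarrow> Circ a \<notin> T" "Circ (Circ a) \<in> T"
proof -
  show "Circ (Circ a) \<in> T"
    using assms saturated_instances[OF sat, of a a]
  unfolding R_B_def R_circ_def Let_def by (simp (no_asm_use), argo)
  then show "Neg (Circ a) \<in> T \<longleftrightarrow> Circ a \<notin> T"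
    using saturated_classical[of "Circ a"] assms by blast
qed

lemma saturated_And:
  assumes "{a, b, And a b, Neg a, Neg b, Neg (And a b), Circ a, Circ b, Circ (And a b)} \<subseteq> \<Lambda>"
  shows "And a b \<in> T \<longleftrightarrow> a \<in> T \<and> b \<in> T"
    "Neg (And a b) \<in> T \<longleftrightarrow> Neg a \<in> T \<or> Neg b \<in> T"
    "Circ (And a b) \<in> T \<longleftrightarrow> Circ a \<in> T \<and> Circ b \<in> T \<or> Circ a \<in> T \<and> a \<notin> T \<or> Circ b \<in> T \<and> b \<notin> T"
  using assms saturated_instances[OF sat, of a b]
  unfolding R_B_def R_circ_def Let_def by (simp (no_asm_use), argo)+

lemma saturated_Or:
  assumes "{a, b, Or a b, Neg a, Neg b, Neg (Or a b), Circ a, Circ b, Circ (Or a b)} \<subseteq> \<Lambda>"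
  shows "Or a b \<in> T \<longleftrightarrow> a \<in> T \<or> b \<in> T"
    "Neg (Or a b) \<in> T \<longleftrightarrow> Neg a \<in> T \<and> Neg b \<in> T"
    "Circ (Or a b) \<in> T \<longleftrightarrow> Circ a \<in> T \<and> Circ b \<in> T \<or> Circ a \<in> T \<and> a \<in> T \<or> Circ b \<in> T \<and> b \<in> T"
  using assms saturated_instances[OF sat, of a b]
  unfolding R_B_def R_circ_def Let_def by (simp (no_asm_use), argo)+

end

definition theory_value :: "form set \<Rightarrow> form \<Rightarrow> bool \<times> bool \<times> bool" where
  "theory_value T a = (a \<in> T, Neg a \<in> T, Circ a \<in> T)"

text \<open>
  In each case of the induction the three bits of the compound formula have to be computed from those
  of its components. All formulas involved are generalized subformulas: membership of
  \<open>\<sim>c\<close> and \<open>\<circ>c\<close> must be decided by the rules for every subformula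
  \<open>c\<close>, including \<open>c\<close> of the form \<open>\<sim>a\<close> or \<open>\<circ>a\<close>.
\<close>

lemma eval_theory_value:
  assumes sat: "saturated (R_B \<union> R_circ) (generalized_subformulas S_circ \<Phi>) T"
    and v: "\<And>x. Var x \<in> sub \<Phi> \<Longrightarrow> v x = theory_value T (Var x)"
  shows "a \<in> sub \<Phi> \<Longrightarrow> eval pp6 v a = theory_value T a"
proof (induction a)
  case (Var x)
  then show ?case using v by simp
next
  case Top
  then show ?case
    using saturated_Top[OF sat] by (simp add: generalized_subformulas_S_circ theory_value_def pp6_def)
next
  case Bot
  then show ?case
    using saturated_Bot[OF sat] by (simp add: generalized_subformulas_S_circ theory_value_def pp6_def)
next
  case (Neg a)
  then show ?case
    using saturated_Neg[OF sat, of a] sub_components(1)[of a]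
    by (simp add: generalized_subformulas_S_circ theory_value_def pp6_def)
next
  case (Circ a)
  then show ?case
    using saturated_Circ[OF sat, of a] sub_components(2)[of a]
    by (simp add: generalized_subformulas_S_circ theory_value_def pp6_def)
next
  case (And a b)
  then show ?case
    using saturated_And[OF sat, of a b] sub_components(3)[of a b]
    by (simp add: generalized_subformulas_S_circ theory_value_def pp6_def)
next
  case (Or a b)
  then show ?case
    using saturated_Or[OF sat, of a b] sub_components(4)[of a b]
    by (simp add: generalized_subformulas_S_circ theory_value_def pp6_def)
qed

lemma pp6_big_and: "fst (eval pp6 v (big_and as)) \<longleftrightarrow> (\<forall>a\<in>set as. fst (eval pp6 v a))"
  by (induction as) (auto simp: big_and_def pp6_def split: prod.splits)

lemma pp6_big_or: "fst (eval pp6 v (big_or as)) \<longleftrightarrow> (\<exists>a\<in>set as. fst (eval pp6 v a))"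
  by (induction as) (auto simp: big_or_def pp6_def split: prod.splits)

text \<open>
  Evaluating with the values read off from a saturated \<open>T\<close> makes the first bit of every premise
  true and that of every conclusion false. The elements with first bit true form a prime filter, so
  the meet of the premises is not below the join of the conclusions.
\<close>

lemma pp_valid_proves:
  assumes valid: "pp_valid TYPE('a) (big_and as) (And (big_and as) (big_or bs))"
    and inf: "infinite (UNIV :: 'a set)"
  shows "proves (R_B \<union> R_circ) (generalized_subformulas S_circ (set as \<union> set bs)) (set bs) (set as)"
proof (rule ccontr)
  let ?X = "set as \<union> set bs"
  let ?\<Lambda> = "generalized_subformulas S_circ ?X"
  assume unprovable: "\<not> proves (R_B \<union> R_circ) ?\<Lambda> (set bs) (set as)"
  have X: "?X \<subseteq> sub ?X" unfolding sub_def using subformulas_refl by blast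
  obtain T where T: "set as \<subseteq> T" "T \<inter> set bs = {}" and sat: "saturated (R_B \<union> R_circ) ?\<Lambda> T"
  proof (rule saturated_extension[OF _ _ unprovable])
    show "finite ?\<Lambda>" unfolding generalized_subformulas_S_circ by (simp add: finite_sub)
    show "set as \<subseteq> ?\<Lambda>" unfolding generalized_subformulas_S_circ using X by blast
  qed
  (* Variables that do not occur may take any value in the carrier. *)
  define v where "v = (\<lambda>x. if Var x \<in> sub ?X then theory_value T (Var x) else top_el pp6)"
  have ev: "eval pp6 v a = theory_value T a" if "a \<in> ?X" for a
    by (rule eval_theory_value[OF sat]) (use X that in \<open>auto simp: v_def\<close>)
  have "v x \<in> carrier pp6" for x
    using saturated_classical[OF sat, of "Var x"]
    by (simp add: v_def theory_value_def pp6_def generalized_subformulas_S_circ)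
  then have eq: "eval pp6 v (big_and as) = eval pp6 v (And (big_and as) (big_or bs))"
    by (rule pp_valid_pp6[OF valid inf])
  have "fst (eval pp6 v (big_and as))"
    using T(1) ev unfolding pp6_big_and by (auto simp: theory_value_def)
  then have "fst (eval pp6 v (And (big_and as) (big_or bs)))"
    by (rule subst[where P = fst, OF eq])
  then have "fst (eval pp6 v (big_or bs))"
    by (simp add: pp6_def split: prod.splits)
  then show False
    using T(2) ev unfolding pp6_big_or by (auto simp: theory_value_def)
qed


section \<open>Axiomatization and analyticity\<close>

lemma finite_conclusions: "(\<Pi>, \<Theta>) \<in> R_B \<union> R_circ \<Longrightarrow> finite \<Theta>"
  unfolding R_B_def R_circ_def Let_def by auto

lemma derives_within_mono:
  assumes "derives_within TYPE('n) R \<Lambda> \<Phi> \<Psi>" "\<Lambda> \<subseteq> \<Lambda>'" "\<Phi> \<subseteq> \<Phi>'" "\<Psi> \<subseteq> \<Psi>'"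
  shows "derives_within TYPE('n) R \<Lambda>' \<Phi>' \<Psi>'"
proof -
  obtain r :: "'n rel" and l n \<Gamma> where der: "derivation R r l"
    and root: "is_root r n" "l n = Fmlas \<Gamma>" "\<Gamma> \<subseteq> \<Phi>"
    and leaf: "\<forall>n. is_leaf r n \<longrightarrow> l n = Star \<or> (\<exists>\<Gamma>. l n = Fmlas \<Gamma> \<and> \<Gamma> \<inter> \<Psi> \<noteq> {})"
    and within: "\<forall>n\<in>Field r. \<forall>\<Gamma>. l n = Fmlas \<Gamma> \<longrightarrow> \<Gamma> \<subseteq> \<Lambda>"
    using assms(1) unfolding derives_within_def by (elim exE conjE) (rule that)
  have leaf': "\<forall>n. is_leaf r n \<longrightarrow> l n = Star \<or> (\<exists>\<Gamma>. l n = Fmlas \<Gamma> \<and> \<Gamma> \<inter> \<Psi>' \<noteq> {})"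
    using leaf assms(4) by (meson Int_mono disjoint_iff subsetD)
  have within': "\<forall>n\<in>Field r. \<forall>\<Gamma>. l n = Fmlas \<Gamma> \<longrightarrow> \<Gamma> \<subseteq> \<Lambda>'"
    using within assms(2) by (meson order_trans)
  show ?thesis
    unfolding derives_within_def
    using der root(1,2) order_trans[OF root(3) assms(3)] leaf' within'
    by (intro exI[of _ r] exI[of _ l] exI[of _ n] exI[of _ \<Gamma>] conjI)
qed

lemma derives_imp_pp_consequence:
  assumes "derives TYPE('n) (R_B \<union> R_circ) \<Phi> \<Psi>"
  shows "pp_consequence TYPE('a) \<Phi> \<Psi>"
proof (rule ccontr)
  assume "\<not> pp_consequence TYPE('a) \<Phi> \<Psi>"
  then obtain T where T: "prime_theory TYPE('a) T" "\<Phi> \<subseteq> T" "T \<inter> \<Psi> = {}"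
    by (rule prime_theory_extension)
  from assms have "T \<inter> \<Psi> \<noteq> {}"
    unfolding derives_def by (rule derives_within_sound[OF _ prime_theory_saturated[OF T(1)] T(2)])
  then show False using T(3) by simp
qed

lemma pp_consequence_imp_derives_within:
  assumes "infinite (UNIV :: 'a set)" "infinite (UNIV :: 'n set)"
    and "pp_consequence TYPE('a) \<Phi> \<Psi>"
  shows "derives_within TYPE('n) (R_B \<union> R_circ) (generalized_subformulas S_circ (\<Phi> \<union> \<Psi>)) \<Phi> \<Psi>"
proof -
  obtain as bs where sub: "set as \<subseteq> \<Phi>" "set bs \<subseteq> \<Psi>"
    and valid: "pp_valid TYPE('a) (big_and as) (And (big_and as) (big_or bs))"
    using assms(3) unfolding pp_consequence_def by (elim exE conjE) (rule that)
  let ?\<Lambda> = "generalized_subformulas S_circ (set as \<union> set bs)"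
  have "\<exists>N. path_tree (R_B \<union> R_circ) ?\<Lambda> (set bs) (set as) N"
  proof (rule proves_path_tree)
    show "proves (R_B \<union> R_circ) ?\<Lambda> (set bs) (set as)"
      by (rule pp_valid_proves[OF valid assms(1)])
    show "set as \<subseteq> ?\<Lambda>"
      unfolding generalized_subformulas_def sub_def using subformulas_refl by blast
  qed (rule finite_conclusions)
  then obtain N where "path_tree (R_B \<union> R_circ) ?\<Lambda> (set bs) (set as) N" ..
  then have "derives_within TYPE('n) (R_B \<union> R_circ) ?\<Lambda> (set as) (set bs)"
    using assms(2) by (rule path_tree_derives_within)
  moreover have "?\<Lambda> \<subseteq> generalized_subformulas S_circ (\<Phi> \<union> \<Psi>)"
    using sub by (intro generalized_subformulas_mono) blast
  ultimately show ?thesis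
    using sub by (rule derives_within_mono)
qed

theorem corollary4p3:
  assumes "infinite (UNIV :: 'a set)" and "infinite (UNIV :: 'n set)"
  shows "derives TYPE('n) (R_B \<union> R_circ) = pp_consequence TYPE('a)
    \<and> analytic TYPE('n) S_circ (R_B \<union> R_circ)"
proof
  have "derives TYPE('n) (R_B \<union> R_circ) \<Phi> \<Psi>" if "pp_consequence TYPE('a) \<Phi> \<Psi>" for \<Phi> \<Psi>
    unfolding derives_def
    using derives_within_mono[OF pp_consequence_imp_derives_within[OF assms that]
        subset_UNIV order_refl order_refl] .
  then show "derives TYPE('n) (R_B \<union> R_circ) = pp_consequence TYPE('a)"
    using derives_imp_pp_consequence by (intro ext iffI)
  show "analytic TYPE('n) S_circ (R_B \<union> R_circ)"
    unfolding analytic_def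
  proof (intro allI impI)
    fix \<Phi> \<Psi> assume "derives TYPE('n) (R_B \<union> R_circ) \<Phi> \<Psi>"
    then have "pp_consequence TYPE('a) \<Phi> \<Psi>" by (rule derives_imp_pp_consequence)
    then show "derives_within TYPE('n) (R_B \<union> R_circ) (generalized_subformulas S_circ (\<Phi> \<union> \<Psi>)) \<Phi> \<Psi>"
      by (rule pp_consequence_imp_derives_within[OF assms])
  qed
qed

end
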